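(* Let $K \subset \mathbb{R}^d$ be a compact cusp-free $d$-dimensional set (equal to the closure of its interior), and let $p_1, \ldots, p_n \in \operatorname{conv} K$ be such that every support hyperplane of $K$ contains less than $\frac{n}{d+1}$ of the points $p_1, \ldots, p_n$. Then there exists a projective transformation $\phi$, admissible with respect to $K$, such that \[ \gamma(\phi(K)) = \frac1n \sum_{i=1}^n \phi(p_i). \] In general, $\phi$ is not unique, even modulo affine transformations: there exist $d$, a compact cusp-free $d$-dimensional set $K \subset \mathbb{R}^d$ (equal to the closure of its interior), points $p_1, \ldots, p_n \in \operatorname{conv} K$ such that every support hyperplane of $K$ contains less than $\frac{n}{d+1}$ of them, and two projective transformations $\phi, \psi$, admissible with respect to $K$ and satisfying $\gamma(\phi(K)) = \frac1n \sum_{i=1}^n \phi(p_i)$ and $\gamma(\psi(K)) = \frac1n \sum_{i=1}^n \psi(p_i)$, such that $\phi \circ \psi^{-1}$ is not affine.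
   Context: $\mathbb{R}^d$ is identified with the affine chart $\{(x_0 : x_1 : \cdots : x_d) \mid x_0 \neq 0\}$ of $\mathbb{R}\mathrm{P}^d$. A projective transformation $\phi$ of $\mathbb{R}\mathrm{P}^d$ is admissible for $K \subset \mathbb{R}^d$ if $\phi(\operatorname{conv}(K)) \subset \mathbb{R}^d$; it is affine if it restricts to a map $x \mapsto Ax+b$ of $\mathbb{R}^d$, $A \in \mathrm{GL}(d)$. The centroid of a compact set $K \subset \mathbb{R}^d$ of positive volume is $\gamma(K) = \frac{1}{\operatorname{vol}(K)} \int_K x\, dx$. A $d$-dimensional compact set $K \subset \mathbb{R}^d$ is cusp-free if for every $x \in K \cap \partial \operatorname{conv} K$ there is a (non-degenerate) $d$-simplex contained in $K$ with a vertex at $x$. A support hyperplane of $K$ is a hyperplane that meets $K$ and has $K$ in one of its closed half-spaces. *)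

theory Defs
  imports "HOL-Analysis.Analysis" "HOL-Library.Function_Algebras"
begin

text \<open>
  The dimension is quantified inside the statement, so \<open>\<real>\<^sup>d\<close> is the carrier of the library's
  \<^const>\<open>Euclidean_space\<close>: the real sequences that vanish from index \<open>d\<close> on.
  The pointwise vector space structure on functions makes \<^term>\<open>span\<close>, \<^term>\<open>linear\<close>,
  \<^term>\<open>convex hull S\<close> and \<^term>\<open>affine hull S\<close> applicable to these sequences.
\<close>

instantiation "fun" :: (type, real_vector) real_vector
begin

definition scaleR_fun_def: "scaleR r f = (\<lambda>x. r *\<^sub>R f x)"

instance
  by standard (auto simp: scaleR_fun_def fun_eq_iff scaleR_add_left scaleR_add_right)

end

type_synonym point = "nat \<Rightarrow> real"

abbreviation R_space :: "nat \<Rightarrow> point set"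
  where "R_space d \<equiv> topspace (Euclidean_space d)"

definition lborel_space :: "nat \<Rightarrow> point measure"
  where "lborel_space d =
    distr (\<Pi>\<^sub>M i\<in>{..<d}. lborel) borel (\<lambda>x i. if i < d then x i else 0)"

definition centroid :: "nat \<Rightarrow> point set \<Rightarrow> point"
  where "centroid d K =
    (\<lambda>i. (1 / measure (lborel_space d) K) * (LINT x:K|lborel_space d. x i))"

definition support_hyperplane :: "nat \<Rightarrow> point set \<Rightarrow> point set \<Rightarrow> bool"
  where "support_hyperplane d K H \<longleftrightarrow> H \<inter> K \<noteq> {} \<and>
    (\<exists>a c. (\<exists>i<d. a i \<noteq> 0) \<and> H = {x \<in> R_space d. (\<Sum>i<d. a i * x i) = c} \<and>
      (K \<subseteq> {x \<in> R_space d. (\<Sum>i<d. a i * x i) \<le> c} \<or>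
       K \<subseteq> {x \<in> R_space d. (\<Sum>i<d. a i * x i) \<ge> c}))"

definition full_dimensional :: "nat \<Rightarrow> point set \<Rightarrow> bool"
  where "full_dimensional d K \<longleftrightarrow> K \<subseteq> R_space d \<and> affine hull K = R_space d"

text \<open>
  The simplices below are written out as in the library's \<^const>\<open>simplex\<close>, which is restricted to the
  class \<^class>\<open>euclidean_space\<close>: \<open>C\<close> is the set of the \<open>d + 1\<close> vertices.
\<close>

definition cusp_free :: "nat \<Rightarrow> point set \<Rightarrow> bool"
  where "cusp_free d K \<longleftrightarrow>
    (\<forall>x \<in> K \<inter> (Euclidean_space d frontier_of (convex hull K)).
      \<exists>C. \<not> affine_dependent C \<and> card C = d + 1 \<and> x \<in> C \<and> convex hull C \<subseteq> K)"

text \<open>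
  \<open>\<real>P\<^sup>d\<close> is the set of lines through the origin of \<open>\<real>\<^sup>d\<^sup>+\<^sup>1\<close>.
  The homogeneous coordinate \<open>x\<^sub>0\<close> has index 0, so coordinate \<open>i\<close> of a point of \<open>\<real>\<^sup>d\<close> becomes
  homogeneous coordinate \<open>i + 1\<close>.
\<close>

definition RP :: "nat \<Rightarrow> point set set"
  where "RP d = {span {v} | v. v \<in> R_space (d + 1) \<and> v \<noteq> 0}"

definition chart :: "point \<Rightarrow> point set"
  where "chart x = span {case_nat 1 x}"

definition projective_transformation :: "nat \<Rightarrow> (point set \<Rightarrow> point set) \<Rightarrow> bool"
  where "projective_transformation d \<phi> \<longleftrightarrow>
    (\<exists>L. linear L \<and> bij_betw L (R_space (d + 1)) (R_space (d + 1)) \<and> (\<forall>l \<in> RP d. \<phi> l = L ` l))"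

definition admissible :: "nat \<Rightarrow> (point set \<Rightarrow> point set) \<Rightarrow> point set \<Rightarrow> bool"
  where "admissible d \<phi> K \<longleftrightarrow> \<phi> ` chart ` (convex hull K) \<subseteq> chart ` R_space d"

text \<open>The action on points of the chart; it is meaningful only where \<open>\<phi>\<close> maps into the chart.\<close>

definition act :: "nat \<Rightarrow> (point set \<Rightarrow> point set) \<Rightarrow> point \<Rightarrow> point"
  where "act d \<phi> x = (THE y. y \<in> R_space d \<and> chart y = \<phi> (chart x))"

definition affine_transformation :: "nat \<Rightarrow> (point set \<Rightarrow> point set) \<Rightarrow> bool"
  where "affine_transformation d \<phi> \<longleftrightarrow>
    (\<exists>A b. linear A \<and> bij_betw A (R_space d) (R_space d) \<and> b \<in> R_space d \<and>
      (\<forall>x \<in> R_space d. \<phi> (chart x) = chart (A x + b)))"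

end

theory Submission
  imports Defs
begin

text \<open>
  Fix an interior point \<open>q\<close> of \<open>K\<close>. Up to affine maps, an admissible projective transformation is
  determined by the hyperplane that it sends to infinity, and this hyperplane misses \<open>conv K\<close>. So it
  is the zero set of \<open>denom y x = 1 - \<langle>y, x - q\<rangle>\<close> (empty if it is the hyperplane at
  infinity) for a unique \<open>y\<close> in the interior of the polar body of \<open>K\<close> with respect to \<open>q\<close>, where the
  arguments \<open>d\<close> and \<open>q\<close> of \<open>denom\<close> are suppressed. A representative of the class is
  \<open>\<phi>\<^sub>y x = (x - q) / denom y x\<close> (\<open>proj_map\<close>). The Jacobian of \<open>\<phi>\<^sub>y\<close> is \<open>denom y x\<close> to the power
  \<open>-(d + 1)\<close>, so \<open>\<phi>\<^sub>y K\<close> has volume \<open>w y = \<integral>\<^sub>K (denom y x)^(-(d + 1)) dx\<close> (\<open>proj_volume\<close>).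

  The equation between the centroid and the mean is the equation for critical points of
  \<open>F y = ln (w y) / (d + 1) + (1/n) \<Sum>\<^sub>i ln (denom y p\<^sub>i)\<close>: the gradient of the first summand is the
  centroid of \<open>\<phi>\<^sub>y K\<close>, and that of the second is minus the mean of the points \<open>\<phi>\<^sub>y p\<^sub>i\<close>. Hence it
  is enough that \<open>F\<close> attains its minimum on the open polar body (\<open>exists_minimizer\<close>, used in
  \<open>centroid_at_minimizer\<close>). It does because \<open>F\<close> tends to infinity at the boundary. If \<open>y\<close> tends to a
  boundary point \<open>y0\<close>, the zero set of \<open>denom y0\<close> is a support hyperplane \<open>H\<close> of \<open>K\<close>. Each point \<open>x\<close> of
  \<open>H \<inter> K\<close> is a vertex of a simplex inside \<open>K\<close>, and this gives \<open>w y \<ge> c / denom y x\<close> (\<open>proj_volume_ge_at_cusp_free_point\<close>). A point \<open>p\<^sub>i\<close> on \<open>H\<close>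
  is a convex combination of points of \<open>H \<inter> K\<close>, and therefore \<open>denom y p\<^sub>i \<ge> a / w y\<close>
  (\<open>proj_volume_ge_at_hull_point\<close>). As \<open>H\<close> contains only \<open>k < n / (d + 1)\<close> of the points, \<open>F y\<close> is at
  least \<open>(1 / (d + 1) - k / n) ln (w y)\<close> up to a constant, and \<open>w y\<close> tends to infinity. The
  simplices that enter sit at finitely many points of \<open>H \<inter> K\<close> that depend on \<open>y0\<close> only, so the constants
  \<open>a\<close> and \<open>c\<close> do not change along the way to the boundary. The proof works with \<open>exp (n (d + 1) F)\<close>
  (\<open>objective\<close>), which avoids logarithms.

  \<open>F\<close> need not be convex, and this is the source of the second claim. Let \<open>K\<close> be a
  symmetric subset of the line with most of its mass around \<open>0\<close> and two short intervals at its ends, and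
  place two points close to these ends. Then \<open>y = 0\<close> is critical by symmetry, but it is a local maximum
  of \<open>F\<close>, so there are further critical points.
\<close>

section \<open>Lebesgue measure on sequences supported in an initial segment\<close>

lemma R_space_iff: "x \<in> R_space d \<longleftrightarrow> (\<forall>i\<ge>d. x i = 0)"
  by (simp add: topspace_Euclidean_space)

lemma sets_lborel_space [measurable_cong, simp]: "sets (lborel_space d) = sets borel"
  and space_lborel_space [simp]: "space (lborel_space d) = UNIV"
  by (simp_all add: lborel_space_def)

lemma measurable_pad [measurable]:
  "(\<lambda>x i. if i < d then x i else (0::real)) \<in> (\<Pi>\<^sub>M i\<in>{..<d::nat}. lborel) \<rightarrow>\<^sub>M borel"
proof (rule measurable_coordinatewise_then_product)
  fix i :: nat
  show "(\<lambda>x. if i < d then x i else (0::real)) \<in> (\<Pi>\<^sub>M i\<in>{..<d}. lborel) \<rightarrow>\<^sub>M borel"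
  proof (cases "i < d")
    case True
    then have "(\<lambda>x. x i) \<in> (\<Pi>\<^sub>M i\<in>{..<d}. lborel::real measure) \<rightarrow>\<^sub>M lborel"
      by (intro measurable_component_singleton) auto
    then show ?thesis using True by simp
  qed simp
qed

interpretation lborel_prod: product_sigma_finite "\<lambda>_::nat. lborel :: real measure" ..

lemma emeasure_lborel_affine_vimage:
  assumes "A \<in> sets borel" "(c::real) > 0"
  shows "emeasure lborel A = ennreal c * emeasure lborel ((\<lambda>u. b + c * u) -` A)"
proof -
  have "emeasure lborel A = (\<integral>\<^sup>+x. indicator A x \<partial>lborel)"
    using assms by simp
  also have "\<dots> = ennreal \<bar>c\<bar> * (\<integral>\<^sup>+x. indicator A (b + c * x) \<partial>lborel)"
    using assms by (intro nn_integral_real_affine) auto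
  also have "(\<integral>\<^sup>+x. indicator A (b + c * x) \<partial>lborel) =
      (\<integral>\<^sup>+x. indicator ((\<lambda>u. b + c * u) -` A) x \<partial>lborel)"
    by (simp add: indicator_def)
  also have "(\<lambda>u. b + c * u) -` A \<in> sets borel"
    using assms(1) by (intro measurable_sets_borel[where M=borel]) auto
  then have "(\<integral>\<^sup>+x. indicator ((\<lambda>u. b + c * u) -` A) x \<partial>lborel) = emeasure lborel ((\<lambda>u. b + c * u) -` A)"
    by simp
  finally show ?thesis using assms by simp
qed

text \<open>
  A homothety scales every factor of a product set by \<open>c\<close>, and product sets determine the product
  measure. The change of variables for projective maps is reduced to this one by passing to cones.
\<close>

lemma PiM_lborel_affine:
  assumes c: "c > (0::real)"
  shows "(\<Pi>\<^sub>M i\<in>{..<d}. lborel) =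
    scale_measure (ennreal (c ^ d)) (distr (\<Pi>\<^sub>M i\<in>{..<d}. lborel) (\<Pi>\<^sub>M i\<in>{..<d}. lborel)
      (\<lambda>x. \<lambda>i\<in>{..<d}. b i + c * x i))" (is "?P = scale_measure _ (distr _ _ ?T)")
proof (rule lborel_prod.PiM_eqI[symmetric])
  fix A :: "nat \<Rightarrow> real set" assume A: "\<And>i. i \<in> {..<d} \<Longrightarrow> A i \<in> sets lborel"
  have T [measurable]: "?T \<in> ?P \<rightarrow>\<^sub>M ?P"
    by measurable
  have AP: "Pi\<^sub>E {..<d} A \<in> sets ?P"
    using A by (intro sets_PiM_I_finite) auto
  have V: "(\<lambda>u. b i + c * u) -` A i \<in> sets lborel" if "i < d" for i
    using A[of i] that by (simp, intro measurable_sets_borel[where M=borel]) auto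
  have vim: "?T -` Pi\<^sub>E {..<d} A \<inter> space ?P = Pi\<^sub>E {..<d} (\<lambda>i. (\<lambda>u. b i + c * u) -` A i)"
    by (auto simp: space_PiM PiE_iff extensional_def split: if_splits)
  have "emeasure (scale_measure (ennreal (c ^ d)) (distr ?P ?P ?T)) (Pi\<^sub>E {..<d} A)
      = ennreal (c ^ d) * (\<Prod>i<d. emeasure lborel ((\<lambda>u. b i + c * u) -` A i))"
    using lborel_prod.emeasure_PiM[of "{..<d}" "\<lambda>i. (\<lambda>u. b i + c * u) -` A i"] V
    by (simp add: emeasure_distr[OF T AP] vim)
  also have "\<dots> = (\<Prod>i<d. ennreal c * emeasure lborel ((\<lambda>u. b i + c * u) -` A i))"
    using c by (simp add: prod.distrib ennreal_power)
  also have "\<dots> = (\<Prod>i<d. emeasure lborel (A i))"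
    using A c by (intro prod.cong emeasure_lborel_affine_vimage[symmetric]) auto
  finally show "emeasure (scale_measure (ennreal (c ^ d)) (distr ?P ?P ?T)) (Pi\<^sub>E {..<d} A)
      = (\<Prod>i<d. emeasure lborel (A i))" .
qed auto

lemma nn_integral_lborel_space_PiM:
  assumes [measurable]: "f \<in> borel_measurable borel"
  shows "(\<integral>\<^sup>+x. f x \<partial>lborel_space d) =
    (\<integral>\<^sup>+x. f (\<lambda>i. if i < d then x i else 0) \<partial>(\<Pi>\<^sub>M i\<in>{..<d}. lborel))"
  unfolding lborel_space_def by (intro nn_integral_distr) auto

lemma nn_integral_lborel_space_affine:
  assumes [measurable]: "f \<in> borel_measurable borel" and c: "c > 0" and b: "b \<in> R_space d"
  shows "(\<integral>\<^sup>+x. f x \<partial>lborel_space d) =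
    ennreal (c ^ d) * (\<integral>\<^sup>+x. f (\<lambda>i. b i + c * x i) \<partial>lborel_space d)"
proof -
  let ?P = "\<Pi>\<^sub>M i\<in>{..<d}. lborel :: real measure"
  let ?T = "\<lambda>x. \<lambda>i\<in>{..<d}. b i + c * x i"
  have [measurable]: "(\<lambda>x i. b i + c * x i) \<in> borel \<rightarrow>\<^sub>M (borel :: point measure)"
    by (rule measurable_coordinatewise_then_product) measurable
  have "(\<integral>\<^sup>+x. f x \<partial>lborel_space d) = (\<integral>\<^sup>+x. f (\<lambda>i. if i < d then x i else 0) \<partial>?P)"
    by (rule nn_integral_lborel_space_PiM) measurable
  also have "\<dots> = (\<integral>\<^sup>+x. f (\<lambda>i. if i < d then x i else 0)
      \<partial>scale_measure (ennreal (c ^ d)) (distr ?P ?P ?T))"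
    using PiM_lborel_affine[OF c, of d b] by simp
  also have "\<dots> = ennreal (c ^ d) * (\<integral>\<^sup>+x. f (\<lambda>i. if i < d then ?T x i else 0) \<partial>?P)"
    by (subst nn_integral_scale_measure, measurable) (subst nn_integral_distr, auto)
  also have "(\<integral>\<^sup>+x. f (\<lambda>i. if i < d then ?T x i else 0) \<partial>?P) =
     (\<integral>\<^sup>+x. f (\<lambda>i. b i + c * (if i < d then x i else 0)) \<partial>?P)"
    using b unfolding R_space_iff
    by (intro nn_integral_cong arg_cong[of _ _ f]) (auto simp: fun_eq_iff)
  also have "\<dots> = (\<integral>\<^sup>+x. f (\<lambda>i. b i + c * x i) \<partial>lborel_space d)"
    by (subst nn_integral_lborel_space_PiM) auto
  finally show ?thesis .
qed

lemma closed_R_space: "closed (R_space d)"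
proof -
  have "R_space d = (\<Inter>i\<in>{d..}. {x::point. x i = 0})"
    by (auto simp: R_space_iff)
  moreover have "closed {x::point. x i = 0}" for i
    by (intro closed_Collect_eq continuous_on_product_coordinates continuous_on_const)
  ultimately show ?thesis by auto
qed

lemma AE_R_space: "AE x in lborel_space d. x \<in> R_space d"
  unfolding lborel_space_def
proof (subst AE_distr_iff)
  show "{x \<in> space borel. x \<in> R_space d} \<in> sets borel"
    using closed_R_space[of d] by (simp add: borel_closed)
qed (auto simp: R_space_iff)

definition cube :: "nat \<Rightarrow> point \<Rightarrow> real \<Rightarrow> point set"
  where "cube d q r = {x \<in> R_space d. \<forall>i<d. \<bar>x i - q i\<bar> \<le> r}"

lemma sets_cube [measurable]: "cube d q r \<in> sets borel"
proof -
  have "cube d q r = R_space d \<inter> {x. \<forall>i<d. \<bar>x i - q i\<bar> \<le> r}"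
    by (auto simp: cube_def)
  moreover have "{x\<in>space borel. \<forall>i<d. \<bar>x i - q i\<bar> \<le> r} \<in> sets borel"
    by measurable
  ultimately show ?thesis using closed_R_space[of d] by (auto intro: borel_closed)
qed

lemma emeasure_cube:
  assumes "r \<ge> 0"
  shows "emeasure (lborel_space d) (cube d q r) = ennreal ((2 * r) ^ d)"
proof -
  let ?P = "\<Pi>\<^sub>M i\<in>{..<d}. lborel :: real measure"
  have "emeasure (lborel_space d) (cube d q r) =
     emeasure ?P ((\<lambda>x i. if i < d then x i else 0) -` cube d q r \<inter> space ?P)"
    unfolding lborel_space_def by (intro emeasure_distr) auto
  also have "(\<lambda>x i. if i < d then x i else 0) -` cube d q r \<inter> space ?P
      = Pi\<^sub>E {..<d} (\<lambda>i. {q i - r..q i + r})"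
  proof (intro set_eqI iffI)
    fix x assume "x \<in> (\<lambda>x i. if i < d then x i else 0) -` cube d q r \<inter> space ?P"
    then show "x \<in> Pi\<^sub>E {..<d} (\<lambda>i. {q i - r..q i + r})"
      by (auto simp: cube_def space_PiM PiE_iff abs_le_iff algebra_simps)
  next
    fix x assume x: "x \<in> Pi\<^sub>E {..<d} (\<lambda>i. {q i - r..q i + r})"
    then have "\<bar>x i - q i\<bar> \<le> r" if "i < d" for i
      using PiE_mem[OF x, of i] that by (auto simp: abs_le_iff)
    with x show "x \<in> (\<lambda>x i. if i < d then x i else 0) -` cube d q r \<inter> space ?P"
      by (auto simp: cube_def space_PiM PiE_iff R_space_iff)
  qed
  also have "emeasure ?P \<dots> = (\<Prod>i<d. ennreal (2 * r))"
    using assms by (subst lborel_prod.emeasure_PiM) (auto intro!: prod.cong)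
  also have "\<dots> = ennreal ((2 * r) ^ d)"
    using assms by (simp add: ennreal_power)
  finally show ?thesis .
qed

lemma sigma_finite_lborel_space: "sigma_finite_measure (lborel_space d)"
proof
  let ?Z = "UNIV - R_space d"
  let ?A = "insert ?Z (range (\<lambda>n. cube d (\<lambda>_. 0) (real n)))"
  have Z: "?Z \<in> sets borel"
    using closed_R_space[of d] by (auto intro: borel_closed)
  have Z0: "emeasure (lborel_space d) ?Z = 0"
    using AE_R_space[of d] Z by (subst (asm) AE_iff_measurable[of ?Z]) auto
  have "x \<in> \<Union>?A" for x
  proof (cases "x \<in> R_space d")
    case True
    obtain n where "(\<Sum>i<d. \<bar>x i\<bar>) \<le> real n" using real_arch_simple by blast
    moreover have "\<bar>x i\<bar> \<le> (\<Sum>i<d. \<bar>x i\<bar>)" if "i < d" for i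
      using that by (intro member_le_sum) auto
    ultimately have "x \<in> cube d (\<lambda>_. 0) (real n)"
      using True by (force simp: cube_def)
    then show ?thesis by blast
  qed auto
  then have "\<Union>?A = UNIV" by blast
  moreover have "emeasure (lborel_space d) a \<noteq> \<infinity>" if "a \<in> ?A" for a
    using that Z0 by (auto simp: emeasure_cube)
  moreover have "countable ?A" "?A \<subseteq> sets (lborel_space d)"
    using Z by auto
  ultimately show "\<exists>A. countable A \<and> A \<subseteq> sets (lborel_space d) \<and> \<Union> A = space (lborel_space d) \<and>
      (\<forall>a\<in>A. emeasure (lborel_space d) a \<noteq> \<infinity>)"
    by (intro exI[of _ ?A]) simp
qed

section \<open>Change of variables for projective maps\<close>

definition denom :: "nat \<Rightarrow> point \<Rightarrow> point \<Rightarrow> point \<Rightarrow> real"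
  where "denom d q y x = 1 - (\<Sum>i<d. y i * (x i - q i))"

text \<open>
  The projective map that sends the hyperplane \<open>denom d q y x = 0\<close> to infinity and \<open>q\<close> to the origin.
\<close>

definition proj_map :: "nat \<Rightarrow> point \<Rightarrow> point \<Rightarrow> point \<Rightarrow> point"
  where "proj_map d q y x = (\<lambda>i. (x i - q i) / denom d q y x)"

lemma measurable_snd_coordinate [measurable]:
  "(\<lambda>p. snd p i) \<in> borel_measurable (borel \<Otimes>\<^sub>M (borel :: point measure))"
  by (rule measurable_compose[OF measurable_snd measurable_product_coordinates])

text \<open>
  Substitute \<open>X = t x\<close> in each slice of height \<open>t > 0\<close>: this writes a half-space of
  \<open>\<real>\<^sup>d\<^sup>+\<^sup>1\<close> as a union of rays through the origin, one for each \<open>x\<close> in the affine chart.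
\<close>

lemma nn_integral_cone:
  fixes G :: "real \<Rightarrow> point \<Rightarrow> ennreal"
  assumes [measurable]: "case_prod G \<in> borel_measurable (borel \<Otimes>\<^sub>M borel)"
    and pos: "\<And>t X. t \<le> 0 \<Longrightarrow> G t X = 0"
  shows "(\<integral>\<^sup>+t. \<integral>\<^sup>+X. G t X \<partial>lborel_space d \<partial>lborel) =
    (\<integral>\<^sup>+x. \<integral>\<^sup>+t. ennreal (t ^ d) * indicator {0<..} t * G t (\<lambda>i. t * x i) \<partial>lborel \<partial>lborel_space d)"
proof -
  interpret sigma_finite_measure "lborel_space d"
    by (rule sigma_finite_lborel_space)
  interpret P: pair_sigma_finite "lborel :: real measure" "lborel_space d" ..
  have [measurable]: "(\<lambda>(t, x) i. t * x i) \<in> borel \<Otimes>\<^sub>M borel \<rightarrow>\<^sub>M (borel :: point measure)"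
    by (rule measurable_coordinatewise_then_product) (unfold case_prod_beta', measurable)
  have [measurable]: "(\<lambda>(t, x). G t (\<lambda>i. t * x i)) \<in> borel_measurable (borel \<Otimes>\<^sub>M borel)"
  proof -
    have "(\<lambda>p. case_prod G (fst p, (\<lambda>(t, x) i. t * x i) p)) \<in> borel_measurable (borel \<Otimes>\<^sub>M borel)"
      by measurable
    then show ?thesis by (simp add: case_prod_beta')
  qed
  have "(\<integral>\<^sup>+X. G t X \<partial>lborel_space d) =
      (\<integral>\<^sup>+x. ennreal (t ^ d) * indicator {0<..} t * G t (\<lambda>i. t * x i) \<partial>lborel_space d)" for t
  proof (cases "t > 0")
    case True
    have [measurable]: "G t \<in> borel_measurable borel" "(\<lambda>x. G t (\<lambda>i. t * x i)) \<in> borel_measurable borel"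
      by measurable
    have "(\<integral>\<^sup>+X. G t X \<partial>lborel_space d) =
        ennreal (t ^ d) * (\<integral>\<^sup>+x. G t (\<lambda>i. 0 + t * x i) \<partial>lborel_space d)"
      using True by (intro nn_integral_lborel_space_affine[where b = "\<lambda>_. 0"]) (auto simp: R_space_iff)
    also have "\<dots> = (\<integral>\<^sup>+x. ennreal (t ^ d) * G t (\<lambda>i. t * x i) \<partial>lborel_space d)"
      by (simp add: nn_integral_cmult)
    finally show ?thesis using True by simp
  qed (simp add: pos)
  then have "(\<integral>\<^sup>+t. \<integral>\<^sup>+X. G t X \<partial>lborel_space d \<partial>lborel) =
    (\<integral>\<^sup>+t. \<integral>\<^sup>+x. ennreal (t ^ d) * indicator {0<..} t * G t (\<lambda>i. t * x i) \<partial>lborel_space d \<partial>lborel)"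
    by simp
  also have "\<dots> = (\<integral>\<^sup>+x. \<integral>\<^sup>+t. ennreal (t ^ d) * indicator {0<..} t * G t (\<lambda>i. t * x i) \<partial>lborel \<partial>lborel_space d)"
    by (rule P.Fubini'[symmetric]) (simp add: case_prod_beta')
  finally show ?thesis .
qed

lemma nn_integral_power_Ioc:
  assumes "c \<ge> 0"
  shows "(\<integral>\<^sup>+t. ennreal (t ^ d) * indicator {0<..c} t \<partial>lborel) = ennreal (c ^ (d + 1) / real (d + 1))"
proof -
  have "(\<integral>\<^sup>+t. ennreal (t ^ d) * indicator {0<..c} t \<partial>lborel) =
      (\<integral>\<^sup>+t. ennreal (t ^ d) * indicator {0..c} t \<partial>lborel)"
    using AE_lborel_singleton[of "0::real"]
    by (intro nn_integral_cong_AE) (auto elim!: eventually_mono simp: indicator_def)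
  also have "\<dots> = ennreal (c ^ (d + 1) / real (d + 1) - 0 ^ (d + 1) / real (d + 1))"
    using assms
    by (intro nn_integral_FTC_Icc[where F = "\<lambda>t. t ^ (d + 1) / real (d + 1)"])
      (auto intro!: derivative_eq_intros simp: add_nonneg_eq_0_iff field_simps simp flip: power_Suc
        split: nat_diff_split)
  finally show ?thesis by simp
qed

text \<open>
  Volumes in the chart are volumes of cones in \<open>\<real>\<^sup>d\<^sup>+\<^sup>1\<close>. The projective map \<open>x \<mapsto> x / (1 - \<langle>y, x\<rangle>)\<close> is
  induced by the shear \<open>(t, X) \<mapsto> (t - \<langle>y, X\<rangle>, X)\<close>, which preserves Lebesgue measure since it translates
  each line in the direction of \<open>t\<close>. The truncated cone \<open>0 < t \<le> 1\<close> over the image is the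
  image of the part \<open>0 < t \<le> 1 / (1 - \<langle>y, x\<rangle>)\<close> of the cone over the domain, and integrating \<open>t\<^sup>d\<close> along
  the rays produces the exponent \<open>d + 1\<close>. This replaces the computation of a Jacobian determinant.
\<close>

lemma nn_integral_projective:
  fixes h :: "point \<Rightarrow> ennreal"
  assumes [measurable]: "h \<in> borel_measurable borel"
  shows "(\<integral>\<^sup>+z. h (\<lambda>i. z i / (1 + (\<Sum>i<d. y i * z i))) * indicator {0<..} (1 + (\<Sum>i<d. y i * z i))
      \<partial>lborel_space d) =
    (\<integral>\<^sup>+x. h x * ennreal (inverse ((1 - (\<Sum>i<d. y i * x i)) ^ (d + 1)))
      * indicator {0<..} (1 - (\<Sum>i<d. y i * x i)) \<partial>lborel_space d)" (is "?L = ?R")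
proof -
  interpret sigma_finite_measure "lborel_space d"
    by (rule sigma_finite_lborel_space)
  interpret P: pair_sigma_finite "lborel :: real measure" "lborel_space d" ..
  define b where "b x = (\<Sum>i<d. y i * x i)" for x
  have b [measurable]: "b \<in> borel_measurable borel"
    unfolding b_def by measurable
  have b_scale: "b (\<lambda>i. t * x i) = t * b x" for t x
    by (simp add: b_def sum_distrib_left algebra_simps)
  have hm [measurable]: "(\<lambda>(t, X). h (\<lambda>i. X i / f t X)) \<in> borel_measurable (borel \<Otimes>\<^sub>M borel)"
    if [measurable]: "case_prod f \<in> borel_measurable (borel \<Otimes>\<^sub>M borel)" for f :: "real \<Rightarrow> point \<Rightarrow> real"
  proof -
    have [measurable]: "(\<lambda>(t, X) i. X i / f t X) \<in> borel \<Otimes>\<^sub>M borel \<rightarrow>\<^sub>M (borel :: point measure)"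
      by (rule measurable_coordinatewise_then_product) (unfold case_prod_beta', measurable)
    have "(\<lambda>p. h ((\<lambda>(t, X) i. X i / f t X) p)) \<in> borel_measurable (borel \<Otimes>\<^sub>M borel)"
      by measurable
    then show ?thesis by (simp add: case_prod_beta')
  qed
  \<comment> \<open>\<open>G\<close> is, on the truncated cone over the image, the function \<open>h\<close> pulled back along the inverse of
    the shear and extended constantly along rays.\<close>
  define G where "G t X = h (\<lambda>i. X i / (t + b X)) * (indicator {0<..1} t * indicator {0<..} (t + b X))" for t X
  have hm1 [measurable]: "(\<lambda>(t, X). h (\<lambda>i. X i / (t + b X))) \<in> borel_measurable (borel \<Otimes>\<^sub>M borel)"
    by (rule hm) measurable
  have hm2 [measurable]: "(\<lambda>(t, X). h (\<lambda>i. X i / t)) \<in> borel_measurable (borel \<Otimes>\<^sub>M borel)"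
    by (rule hm) measurable
  have G [measurable]: "case_prod G \<in> borel_measurable (borel \<Otimes>\<^sub>M borel)"
    using hm1 unfolding G_def case_prod_beta' by measurable
  define I where "I = (\<integral>\<^sup>+t. \<integral>\<^sup>+X. G t X \<partial>lborel_space d \<partial>lborel)"
  define k where "k = ennreal (1 / real (d + 1))"
  have "I = (\<integral>\<^sup>+z. \<integral>\<^sup>+t. ennreal (t ^ d) * indicator {0<..} t * G t (\<lambda>i. t * z i) \<partial>lborel \<partial>lborel_space d)"
    unfolding I_def by (rule nn_integral_cone) (auto simp: G_def)
  also have "\<dots> = (\<integral>\<^sup>+z. k * (h (\<lambda>i. z i / (1 + b z)) * indicator {0<..} (1 + b z)) \<partial>lborel_space d)"
  proof (rule nn_integral_cong)
    fix z
    have "ennreal (t ^ d) * indicator {0<..} t * G t (\<lambda>i. t * z i) =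
        (h (\<lambda>i. z i / (1 + b z)) * indicator {0<..} (1 + b z)) * (ennreal (t ^ d) * indicator {0<..1} t)" for t
    proof (cases "t > 0")
      case True
      have "t + t * b z = t * (1 + b z)" by (simp add: algebra_simps)
      then show ?thesis using True
        by (simp add: G_def b_scale indicator_def zero_less_mult_iff mult.commute)
    qed (simp add: indicator_def)
    then have "(\<integral>\<^sup>+t. ennreal (t ^ d) * indicator {0<..} t * G t (\<lambda>i. t * z i) \<partial>lborel) =
        (h (\<lambda>i. z i / (1 + b z)) * indicator {0<..} (1 + b z)) *
          (\<integral>\<^sup>+t. ennreal (t ^ d) * indicator {0<..1} t \<partial>lborel)"
      by (simp only:) (intro nn_integral_cmult, measurable)
    then show "(\<integral>\<^sup>+t. ennreal (t ^ d) * indicator {0<..} t * G t (\<lambda>i. t * z i) \<partial>lborel) =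
        k * (h (\<lambda>i. z i / (1 + b z)) * indicator {0<..} (1 + b z))"
      by (simp add: nn_integral_power_Ioc k_def mult.commute)
  qed
  also have "\<dots> = k * ?L"
  proof -
    have [measurable]: "(\<lambda>z i. z i / (1 + b z)) \<in> borel \<rightarrow>\<^sub>M (borel :: point measure)"
      by (rule measurable_coordinatewise_then_product) measurable
    have "(\<lambda>z. h (\<lambda>i. z i / (1 + b z))) \<in> borel_measurable borel"
      by measurable
    then show ?thesis
      unfolding b_def[symmetric] by (intro nn_integral_cmult) measurable
  qed
  finally have L: "I = k * ?L" .
  have "I = (\<integral>\<^sup>+X. \<integral>\<^sup>+t. G t X \<partial>lborel \<partial>lborel_space d)"
    unfolding I_def by (rule P.Fubini'[symmetric]) simp
  also have "\<dots> = (\<integral>\<^sup>+X. \<integral>\<^sup>+s. G (s - b X) X \<partial>lborel \<partial>lborel_space d)"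
  proof (rule nn_integral_cong)
    fix X
    show "(\<integral>\<^sup>+t. G t X \<partial>lborel) = (\<integral>\<^sup>+s. G (s - b X) X \<partial>lborel)"
      using nn_integral_real_affine[of "\<lambda>t. G t X" 1 "- b X"] by simp
  qed
  also have "\<dots> = (\<integral>\<^sup>+s. \<integral>\<^sup>+X. G (s - b X) X \<partial>lborel_space d \<partial>lborel)"
    by (rule P.Fubini') simp
  also have "\<dots> = (\<integral>\<^sup>+x. \<integral>\<^sup>+s. ennreal (s ^ d) * indicator {0<..} s *
      G (s - b (\<lambda>i. s * x i)) (\<lambda>i. s * x i) \<partial>lborel \<partial>lborel_space d)"
    by (rule nn_integral_cone) (auto simp: G_def)
  also have "\<dots> = (\<integral>\<^sup>+x. k * (h x * ennreal (inverse ((1 - b x) ^ (d + 1))) * indicator {0<..} (1 - b x))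
     \<partial>lborel_space d)"
  proof (rule nn_integral_cong)
    fix x
    have "ennreal (s ^ d) * indicator {0<..} s * G (s - b (\<lambda>i. s * x i)) (\<lambda>i. s * x i) =
        (h x * indicator {0<..} (1 - b x)) * (ennreal (s ^ d) * indicator {0<..inverse (1 - b x)} s)" for s
    proof (cases "s > 0")
      case True
      have *: "s - s * b x = s * (1 - b x)" by (simp add: algebra_simps)
      have "s * (1 - b x) \<le> 1 \<longleftrightarrow> s \<le> inverse (1 - b x)" if "1 - b x > 0"
        using that by (simp add: field_simps)
      moreover have "G (s - b (\<lambda>i. s * x i)) (\<lambda>i. s * x i) = h x * indicator {0<..1} (s * (1 - b x))"
        using True by (simp add: G_def b_scale flip: *)
      ultimately show ?thesis using True
        by (simp add: indicator_def zero_less_mult_iff mult.commute)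
    qed (simp add: indicator_def)
    then have "(\<integral>\<^sup>+s. ennreal (s ^ d) * indicator {0<..} s * G (s - b (\<lambda>i. s * x i)) (\<lambda>i. s * x i) \<partial>lborel) =
        (h x * indicator {0<..} (1 - b x)) *
          (\<integral>\<^sup>+s. ennreal (s ^ d) * indicator {0<..inverse (1 - b x)} s \<partial>lborel)"
      by (simp only:) (intro nn_integral_cmult, measurable)
    moreover have "(\<integral>\<^sup>+s. ennreal (s ^ d) * indicator {0<..inverse (1 - b x)} s \<partial>lborel) =
        k * ennreal (inverse ((1 - b x) ^ (d + 1)))" if "1 - b x > 0"
      using that by (subst nn_integral_power_Ioc)
        (simp_all add: k_def ennreal_mult'[symmetric] power_inverse divide_inverse mult.commute del: power_Suc)
    ultimately show "(\<integral>\<^sup>+s. ennreal (s ^ d) * indicator {0<..} s *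
        G (s - b (\<lambda>i. s * x i)) (\<lambda>i. s * x i) \<partial>lborel) =
        k * (h x * ennreal (inverse ((1 - b x) ^ (d + 1))) * indicator {0<..} (1 - b x))"
      by (cases "1 - b x > 0") (simp_all add: mult_ac)
  qed
  also have "\<dots> = k * ?R"
    unfolding b_def[symmetric] by (intro nn_integral_cmult) measurable
  finally have R: "I = k * ?R" .
  have "k \<noteq> 0" "k \<noteq> top"
    by (simp_all add: k_def)
  moreover have "k * ?L = k * ?R"
    using L R by simp
  ultimately show ?thesis
    by (subst (asm) ennreal_mult_cancel_left) auto
qed

lemma continuous_on_denom [continuous_intros]: "continuous_on S (denom d q y)"
  unfolding denom_def
  by (intro continuous_intros continuous_on_subset[OF continuous_on_product_coordinates]) auto

lemma borel_measurable_denom [measurable]: "denom d q y \<in> borel_measurable borel"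
  by (intro borel_measurable_continuous_onI continuous_on_denom)

lemma borel_measurable_proj_map [measurable]: "proj_map d q y \<in> borel \<rightarrow>\<^sub>M borel"
  unfolding proj_map_def by (rule measurable_coordinatewise_then_product) measurable

lemma continuous_on_proj_map:
  assumes "\<And>x. x \<in> S \<Longrightarrow> denom d q y x \<noteq> 0"
  shows "continuous_on S (proj_map d q y)"
  unfolding proj_map_def using assms
  by (intro continuous_on_coordinatewise_then_product continuous_intros
      continuous_on_subset[OF continuous_on_product_coordinates]) auto

lemma proj_map_in_R_space: "x \<in> R_space d \<Longrightarrow> q \<in> R_space d \<Longrightarrow> proj_map d q y x \<in> R_space d"
  by (simp add: R_space_iff proj_map_def)

lemma denom_proj_map:
  assumes "denom d q y x \<noteq> 0"
  shows "1 + (\<Sum>i<d. y i * proj_map d q y x i) = inverse (denom d q y x)"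
proof -
  have "(\<Sum>i<d. y i * proj_map d q y x i) = (\<Sum>i<d. y i * (x i - q i)) / denom d q y x"
    by (simp add: proj_map_def sum_divide_distrib)
  then have "(\<Sum>i<d. y i * proj_map d q y x i) = (1 - denom d q y x) / denom d q y x"
    by (simp add: denom_def)
  then show ?thesis using assms
    by (simp add: field_simps)
qed

lemma nn_integral_proj_map_image:
  assumes K [measurable]: "K \<in> sets borel" and q: "q \<in> R_space d"
    and pos: "\<And>x. x \<in> K \<Longrightarrow> denom d q y x > 0"
    and f [measurable]: "f \<in> borel_measurable borel"
  shows "(\<integral>\<^sup>+z\<in>proj_map d q y ` K. f z \<partial>lborel_space d) =
    (\<integral>\<^sup>+x\<in>K. f (proj_map d q y x) * ennreal (inverse (denom d q y x ^ (d + 1))) \<partial>lborel_space d)"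
proof -
  define b where "b z = (\<Sum>i<d. y i * z i)" for z
  have [measurable]: "b \<in> borel_measurable borel" unfolding b_def by measurable
  have b_div: "b (\<lambda>i. z i / c) = b z / c" for z c
    by (simp add: b_def sum_divide_distrib)
  have denom_b: "denom d q y (\<lambda>i. q i + 1 * x i) = 1 - b x" for x
    by (simp add: denom_def b_def)
  have [measurable]: "(\<lambda>x i. q i + 1 * x i) \<in> borel \<rightarrow>\<^sub>M (borel :: point measure)"
    by (rule measurable_coordinatewise_then_product) measurable
  define h where "h x = f (proj_map d q y (\<lambda>i. q i + 1 * x i)) * indicator K (\<lambda>i. q i + 1 * x i)" for x
  have [measurable]: "h \<in> borel_measurable borel"
    unfolding h_def by measurable
  have img: "f z * indicator (proj_map d q y ` K) z = h (\<lambda>i. z i / (1 + b z)) * indicator {0<..} (1 + b z)" for z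
  proof (cases "z \<in> proj_map d q y ` K")
    case True
    then obtain x where x: "x \<in> K" "z = proj_map d q y x" by blast
    have eq: "1 + b z = inverse (denom d q y x)"
      using denom_proj_map[of d q y x] pos[OF x(1)] x(2) by (simp add: b_def)
    then have "(\<lambda>i. q i + 1 * (z i / (1 + b z))) = x"
      using pos[OF x(1)] by (auto simp: x(2) proj_map_def fun_eq_iff)
    then have "h (\<lambda>i. z i / (1 + b z)) = f z"
      using x by (simp add: h_def)
    moreover have "1 + b z > 0"
      using eq pos[OF x(1)] by simp
    ultimately show ?thesis using True by simp
  next
    case False
    show ?thesis
    proof (cases "1 + b z > 0")
      case True
      let ?x = "\<lambda>i. q i + 1 * (z i / (1 + b z))"
      have "denom d q y ?x = 1 - b z / (1 + b z)"
        by (simp only: denom_b b_div)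
      also have "\<dots> = 1 / (1 + b z)"
        using True by (simp add: field_simps)
      finally have eq: "proj_map d q y ?x = z"
        using True by (simp add: proj_map_def fun_eq_iff)
      have "?x \<notin> K"
      proof
        assume "?x \<in> K"
        then have "proj_map d q y ?x \<in> proj_map d q y ` K" by (rule imageI)
        then show False using False unfolding eq by contradiction
      qed
      then show ?thesis using False by (simp add: h_def)
    qed (use False in simp)
  qed
  have "(\<integral>\<^sup>+z\<in>proj_map d q y ` K. f z \<partial>lborel_space d) =
    (\<integral>\<^sup>+x. h x * ennreal (inverse ((1 - b x) ^ (d + 1))) * indicator {0<..} (1 - b x) \<partial>lborel_space d)"
  proof -
    have "(\<integral>\<^sup>+z\<in>proj_map d q y ` K. f z \<partial>lborel_space d) =
      (\<integral>\<^sup>+z. h (\<lambda>i. z i / (1 + b z)) * indicator {0<..} (1 + b z) \<partial>lborel_space d)"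
      by (intro nn_integral_cong img)
    also have "\<dots> = (\<integral>\<^sup>+x. h x * ennreal (inverse ((1 - b x) ^ (d + 1))) * indicator {0<..} (1 - b x) \<partial>lborel_space d)"
      unfolding b_def by (rule nn_integral_projective) measurable
    finally show ?thesis .
  qed
  also have "\<dots> = (\<integral>\<^sup>+x. f (proj_map d q y (\<lambda>i. q i + 1 * x i)) *
      ennreal (inverse (denom d q y (\<lambda>i. q i + 1 * x i) ^ (d + 1))) * indicator K (\<lambda>i. q i + 1 * x i) \<partial>lborel_space d)"
  proof (rule nn_integral_cong)
    fix x
    show "h x * ennreal (inverse ((1 - b x) ^ (d + 1))) * indicator {0<..} (1 - b x) =
      f (proj_map d q y (\<lambda>i. q i + 1 * x i)) *
      ennreal (inverse (denom d q y (\<lambda>i. q i + 1 * x i) ^ (d + 1))) * indicator K (\<lambda>i. q i + 1 * x i)"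
      using pos[of "\<lambda>i. q i + 1 * x i"] unfolding denom_b h_def
      by (cases "(\<lambda>i. q i + 1 * x i) \<in> K") simp_all
  qed
  also have "\<dots> = (\<integral>\<^sup>+x\<in>K. f (proj_map d q y x) * ennreal (inverse (denom d q y x ^ (d + 1))) \<partial>lborel_space d)"
    using nn_integral_lborel_space_affine[of "\<lambda>x. f (proj_map d q y x) *
      ennreal (inverse (denom d q y x ^ (d + 1))) * indicator K x" 1 q d] q
    by simp
  finally show ?thesis .
qed

section \<open>First-order optimality\<close>

text \<open>
  Only an upper estimate is needed to read off a first-order condition at a minimum, so this replaces
  differentiation under the integral sign.
\<close>

lemma inverse_power_le_quadratic:
  "\<exists>C\<ge>0. \<forall>s. \<bar>s\<bar> \<le> 1/2 \<longrightarrow> inverse ((1 - s) ^ N) \<le> 1 + real N * s + C * (s::real)\<^sup>2"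
proof (induction N)
  case 0
  then show ?case by (intro exI[of _ 0]) simp
next
  case (Suc N)
  then obtain C where C: "C \<ge> 0"
    "\<And>s::real. \<bar>s\<bar> \<le> 1/2 \<Longrightarrow> inverse ((1 - s) ^ N) \<le> 1 + real N * s + C * s\<^sup>2" by blast
  have "inverse ((1 - s) ^ Suc N) \<le> 1 + real (Suc N) * s + (2 * C + 2 + 2 * real N) * s\<^sup>2"
    if s: "\<bar>s\<bar> \<le> 1/2" for s :: real
  proof -
    have s': "s \<le> 1/2" "- 1/2 \<le> s" using s by auto
    have one: "inverse (1 - s) \<le> 1 + s + 2 * s\<^sup>2"
    proof -
      have "1 \<le> (1 + s + 2 * s\<^sup>2) * (1 - s)"
      proof -
        have "(1 + s + 2 * s\<^sup>2) * (1 - s) - 1 = s\<^sup>2 * (1 - 2 * s)"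
          by (simp add: power2_eq_square algebra_simps)
        also have "\<dots> \<ge> 0" using s' by simp
        finally show ?thesis by simp
      qed
      then show ?thesis using s' by (simp add: inverse_eq_divide divide_simps)
    qed
    have two: "inverse (1 - s) \<le> 2"
      using s' by (simp add: inverse_eq_divide divide_simps)
    have "inverse ((1 - s) ^ Suc N) = inverse ((1 - s) ^ N) * inverse (1 - s)"
      by simp
    also have "\<dots> \<le> (1 + real N * s + C * s\<^sup>2) * inverse (1 - s)"
      using C(2)[OF s] s' by (intro mult_right_mono) auto
    also have "\<dots> = inverse (1 - s) + real N * s * inverse (1 - s) + C * s\<^sup>2 * inverse (1 - s)"
      by (simp add: algebra_simps)
    also have "real N * s * inverse (1 - s) = real N * s + real N * s\<^sup>2 * inverse (1 - s)"
      using s' by (simp add: field_simps power2_eq_square)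
    also have "inverse (1 - s) + (real N * s + real N * s\<^sup>2 * inverse (1 - s)) + C * s\<^sup>2 * inverse (1 - s)
       \<le> (1 + s + 2 * s\<^sup>2) + (real N * s + real N * s\<^sup>2 * 2) + C * s\<^sup>2 * 2"
      using one two C(1) by (intro add_mono mult_left_mono order_refl) auto
    also have "\<dots> = 1 + real (Suc N) * s + (2 * C + 2 + 2 * real N) * s\<^sup>2"
      by (simp add: algebra_simps)
    finally show ?thesis .
  qed
  then show ?case using C(1) by (intro exI[of _ "2 * C + 2 + 2 * real N"]) auto
qed

lemma linear_coefficient_eq_0:
  fixes D E \<epsilon> :: real
  assumes "\<epsilon> > 0" and ge: "\<And>t. \<bar>t\<bar> < \<epsilon> \<Longrightarrow> 0 \<le> t * D + E * t\<^sup>2"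
  shows "D = 0"
proof -
  have lim: "((\<lambda>t. D + E * t) \<longlongrightarrow> D) (at 0 within S)" for S
    by (auto intro!: tendsto_eq_intros)
  have "eventually (\<lambda>t. 0 \<le> D + E * t) (at_right 0)"
    unfolding eventually_at_right_field
  proof (intro exI[of _ \<epsilon>] conjI allI impI)
    fix t assume t: "0 < t" "t < \<epsilon>"
    then have "0 \<le> t * (D + E * t)"
      using ge[of t] by (simp add: algebra_simps power2_eq_square)
    then show "0 \<le> D + E * t" using t by (simp add: zero_le_mult_iff)
  qed (use assms in auto)
  then have "0 \<le> D"
    by (intro tendsto_lowerbound[OF lim]) auto
  moreover have "eventually (\<lambda>t. D + E * t \<le> 0) (at_left 0)"
    unfolding eventually_at_left_field
  proof (intro exI[of _ "-\<epsilon>"] conjI allI impI)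
    fix t assume t: "- \<epsilon> < t" "t < 0"
    then have "0 \<le> t * (D + E * t)"
      using ge[of t] by (simp add: algebra_simps power2_eq_square)
    then show "D + E * t \<le> 0" using t by (simp add: zero_le_mult_iff)
  qed (use assms in auto)
  then have "D \<le> 0"
    by (intro tendsto_upperbound[OF lim]) auto
  ultimately show ?thesis by simp
qed

text \<open>
  Here \<open>f t\<close> is the relative change of a volume with first-order coefficient \<open>N g\<close>. By
  \<open>1 + u \<le> exp u\<close>, the product is at most the exponential of
  \<open>t N (n g - \<Sum>\<^sub>i a\<^sub>i)\<close> up to a quadratic error; it is at least \<open>1\<close> for small \<open>t\<close> of both signs, hence
  the linear coefficient vanishes.
\<close>

lemma mean_eq_of_product_ge_1:
  fixes f :: "real \<Rightarrow> real" and a :: "nat \<Rightarrow> real"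
  assumes "\<epsilon> > 0" "N > 0"
    and upper: "\<And>t. \<bar>t\<bar> < \<epsilon> \<Longrightarrow> 0 \<le> f t \<and> f t \<le> 1 + real N * t * g + C * t\<^sup>2"
    and pos: "\<And>t i. \<bar>t\<bar> < \<epsilon> \<Longrightarrow> i \<in> {1..n} \<Longrightarrow> 1 - t * a i \<ge> 0"
    and ge: "\<And>t. \<bar>t\<bar> < \<epsilon> \<Longrightarrow> 1 \<le> f t ^ n * (\<Prod>i=1..n. (1 - t * a i) ^ N)"
  shows "real n * g = (\<Sum>i=1..n. a i)"
proof -
  have "real N * (real n * g - (\<Sum>i=1..n. a i)) = 0"
  proof (rule linear_coefficient_eq_0[OF \<open>\<epsilon> > 0\<close>])
    fix t assume t: "\<bar>t\<bar> < \<epsilon>"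
    define u where "u = real N * t * g + C * t\<^sup>2"
    have "f t \<le> exp u"
      using upper[OF t] exp_ge_add_one_self[of u] unfolding u_def by linarith
    then have 1: "f t ^ n \<le> exp (real n * u)"
      using upper[OF t] by (simp add: exp_of_nat_mult power_mono)
    have "(1 - t * a i) ^ N \<le> exp (- real N * t * a i)" if "i \<in> {1..n}" for i
    proof -
      have "(1 - t * a i) ^ N \<le> exp (- t * a i) ^ N"
        using pos[OF t that] exp_ge_add_one_self[of "- t * a i"] by (intro power_mono) auto
      then show ?thesis by (simp add: exp_of_nat_mult[symmetric] algebra_simps)
    qed
    then have "(\<Prod>i=1..n. (1 - t * a i) ^ N) \<le> (\<Prod>i=1..n. exp (- real N * t * a i))"
      using pos[OF t] by (intro prod_mono) auto
    then have 2: "(\<Prod>i=1..n. (1 - t * a i) ^ N) \<le> exp (\<Sum>i=1..n. - real N * t * a i)"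
      by (simp add: exp_sum)
    have "1 \<le> f t ^ n * (\<Prod>i=1..n. (1 - t * a i) ^ N)"
      using ge[OF t] .
    also have "\<dots> \<le> exp (real n * u) * exp (\<Sum>i=1..n. - real N * t * a i)"
      using 1 2 pos[OF t] by (intro mult_mono prod_nonneg) auto
    also have "\<dots> = exp (real n * u - real N * t * (\<Sum>i=1..n. a i))"
      by (simp add: exp_add[symmetric] sum_distrib_left sum_negf)
    finally have "0 \<le> real n * u - real N * t * (\<Sum>i=1..n. a i)" by simp
    then show "0 \<le> t * (real N * (real n * g - (\<Sum>i=1..n. a i))) + real n * C * t\<^sup>2"
      by (simp add: u_def algebra_simps)
  qed
  then show ?thesis using \<open>N > 0\<close> by simp
qed

section \<open>Simplices and convex hulls in the space of sequences\<close>

lemma sum_point_apply: "(\<Sum>v\<in>S. f v :: point) i = (\<Sum>v\<in>S. f v i)"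
  by (induction S rule: infinite_finite_induct) (auto simp: zero_fun_def plus_fun_def)

lemma openin_Euclidean_space_cube:
  assumes "openin (Euclidean_space d) U" "p \<in> U"
  shows "\<exists>r>0. cube d p r \<subseteq> U"
proof -
  obtain V where V: "openin (product_topology (\<lambda>_. euclidean) UNIV) V" "U = V \<inter> {x::point. \<forall>i\<ge>d. x i = 0}"
    using assms(1) by (auto simp: Euclidean_space_def openin_subtopology)
  obtain X :: "nat \<Rightarrow> real set" where X: "p \<in> Pi\<^sub>E UNIV X" "\<And>i. open (X i)" "Pi\<^sub>E UNIV X \<subseteq> V"
    using product_topology_open_contains_basis[OF V(1), of p] assms(2) V(2) by auto
  have "\<exists>e>0. cball (p i) e \<subseteq> X i" for i
    using X(1,2) open_contains_cball by (metis PiE_mem UNIV_I)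
  then obtain e where e: "\<And>i. e i > 0" "\<And>i. cball (p i) (e i) \<subseteq> X i" by metis
  define r where "r = Min (insert 1 (e ` {..<d}))"
  have "r > 0" using e(1) by (simp add: r_def)
  moreover have "cube d p r \<subseteq> U"
  proof
    fix x assume x: "x \<in> cube d p r"
    have "x i \<in> X i" for i
    proof (cases "i < d")
      case True
      then have "r \<le> e i" unfolding r_def by (intro Min_le) auto
      with x True have "x i \<in> cball (p i) (e i)"
        by (force simp: cube_def dist_real_def abs_minus_commute)
      then show ?thesis using e(2) by blast
    next
      case False
      then have "x i = p i"
        using x assms(2) V(2) by (auto simp: cube_def R_space_iff)
      then show ?thesis using X(1) by auto
    qed
    then have "x \<in> V" using X(3) by auto
    then show "x \<in> U" using x V(2) by (auto simp: cube_def R_space_iff)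
  qed
  ultimately show ?thesis by blast
qed

definition unit_point :: "nat \<Rightarrow> point"
  where "unit_point k = (\<lambda>i. if i = k then 1 else 0)"

lemma R_space_eq_sum_units:
  assumes "x \<in> R_space d"
  shows "x = (\<Sum>k<d. x k *\<^sub>R unit_point k)"
proof
  fix i
  show "x i = (\<Sum>k<d. x k *\<^sub>R unit_point k) i"
    using assms by (cases "i < d")
      (auto simp: sum_point_apply scaleR_fun_def unit_point_def R_space_iff sum.delta if_distrib[of "\<lambda>u. _ * u"] cong: if_cong)
qed

lemma R_space_diff: "x \<in> R_space d \<Longrightarrow> y \<in> R_space d \<Longrightarrow> x - y \<in> R_space d"
  by (simp add: R_space_iff fun_diff_def)

text \<open>
  Moving the barycentre by a small vector changes the barycentric coordinates by a small amount, so they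
  stay nonnegative. The coordinates of the unit vectors exist because \<open>d\<close> independent edge vectors span
  \<open>\<real>\<^sup>d\<close>.
\<close>

lemma simplex_contains_cube:
  assumes C: "\<not> affine_dependent C" "card C = d + 1" "C \<subseteq> R_space d"
  shows "\<exists>b r. r > 0 \<and> b \<in> R_space d \<and> cube d b r \<subseteq> convex hull C"
proof -
  have finC: "finite C" using C(2) by (metis Suc_eq_plus1 card.infinite nat.distinct(1))
  obtain v0 where v0: "v0 \<in> C" using C(2) by (metis Suc_eq_plus1 card.empty equals0I nat.distinct(1))
  define C' where "C' = C - {v0}"
  have C': "finite C'" "card C' = d" "v0 \<notin> C'" "C = insert v0 C'"
    using finC C(2) v0 by (auto simp: C'_def)
  define B where "B = (\<lambda>x. x - v0) ` C'"
  have inj: "inj_on (\<lambda>x. x - v0) C'" by (auto simp: inj_on_def)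
  have B: "finite B" "card B = d" "B \<subseteq> R_space d"
    using C' C(3) by (auto simp: B_def card_image[OF inj] intro!: R_space_diff)
  have indB: "independent B"
  proof
    assume "dependent B"
    moreover have "B = {x - v0 |x. x \<in> C'}" by (auto simp: B_def)
    ultimately show False
      using dependent_imp_affine_dependent[of v0 C'] C(1) C'(3,4) by auto
  qed
  define E where "E = unit_point ` {..<d}"
  have E: "finite E" "card E \<le> d" by (auto simp: E_def intro: order_trans[OF card_image_le])
  have RE: "R_space d \<subseteq> span E"
  proof
    fix x assume "x \<in> R_space d"
    then have "x = (\<Sum>k<d. x k *\<^sub>R unit_point k)" by (rule R_space_eq_sum_units)
    also have "\<dots> \<in> span E"
      by (intro span_sum span_scale span_base) (auto simp: E_def)
    finally show "x \<in> span E" .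
  qed
  have spanB: "R_space d \<subseteq> span B"
  proof
    fix x assume x: "x \<in> R_space d"
    show "x \<in> span B"
    proof (rule ccontr)
      assume nx: "x \<notin> span B"
      then have "independent (insert x B)" using indB by (auto simp: independent_insert)
      moreover have "insert x B \<subseteq> span E" using RE x B(3) by blast
      ultimately have "card (insert x B) \<le> card E"
        using independent_span_bound[OF E(1)] by blast
      moreover have "x \<notin> B" using nx span_base by blast
      ultimately show False using B E by simp
    qed
  qed
  have "\<exists>c. unit_point k = (\<Sum>v\<in>C'. c v *\<^sub>R (v - v0))" if "k < d" for k
  proof -
    have "unit_point k \<in> R_space d" using that by (auto simp: R_space_iff unit_point_def)
    then have "unit_point k \<in> range (\<lambda>u. \<Sum>v\<in>B. u v *\<^sub>R v)"
      using spanB span_finite[OF B(1)] by blast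
    then obtain u where "unit_point k = (\<Sum>v\<in>B. u v *\<^sub>R v)" by blast
    also have "\<dots> = (\<Sum>v\<in>C'. u (v - v0) *\<^sub>R (v - v0))"
      unfolding B_def by (simp add: sum.reindex[OF inj])
    finally show ?thesis by (intro exI[of _ "\<lambda>v. u (v - v0)"])
  qed
  then obtain c where c: "\<And>k. k < d \<Longrightarrow> unit_point k = (\<Sum>v\<in>C'. c k v *\<^sub>R (v - v0))" by metis
  define N where "N = real (d + 1)"
  define M where "M = 1 + (\<Sum>k<d. \<Sum>v\<in>C'. \<bar>c k v\<bar>)"
  have M: "M \<ge> 1" by (simp add: M_def sum_nonneg)
  have N: "N > 0" by (simp add: N_def)
  \<comment> \<open>A displacement with coordinates at most \<open>r\<close> changes the barycentric coordinates by at most \<open>1 / N\<close>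
    in total, and all of them are \<open>1 / N\<close> at the barycentre.\<close>
  define r where "r = 1 / (N * M)"
  have r: "r > 0" using M N by (simp add: r_def)
  define b where "b = v0 + (\<Sum>v\<in>C'. (1 / N) *\<^sub>R (v - v0))"
  have bR: "b \<in> R_space d"
    using v0 C(3) C'(4) by (auto simp: b_def R_space_iff plus_fun_def fun_diff_def scaleR_fun_def sum_point_apply
        intro!: sum.neutral)
  have "cube d b r \<subseteq> convex hull C"
  proof
    fix x assume x: "x \<in> cube d b r"
    have xb: "\<bar>(x - b) k\<bar> \<le> r" if "k < d" for k
      using x that by (auto simp: cube_def fun_diff_def)
    have xbR: "x - b \<in> R_space d" using x bR by (auto simp: cube_def intro: R_space_diff)
    define w where "w v = (\<Sum>k<d. (x - b) k * c k v)" for v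
    have "x - b = (\<Sum>k<d. (x - b) k *\<^sub>R unit_point k)"
      by (rule R_space_eq_sum_units[OF xbR])
    also have "\<dots> = (\<Sum>k<d. (x - b) k *\<^sub>R (\<Sum>v\<in>C'. c k v *\<^sub>R (v - v0)))"
      by (intro sum.cong) (simp_all add: c)
    also have "\<dots> = (\<Sum>v\<in>C'. w v *\<^sub>R (v - v0))"
      unfolding w_def scaleR_sum_right scaleR_sum_left by (subst sum.swap) simp
    finally have "x = b + (\<Sum>v\<in>C'. w v *\<^sub>R (v - v0))"
      by (metis add.commute diff_add_cancel)
    then have x_eq: "x = v0 + (\<Sum>v\<in>C'. (1 / N + w v) *\<^sub>R (v - v0))"
      by (simp only: b_def scaleR_add_left sum.distrib add.assoc)
    have "(\<Sum>v\<in>C'. \<bar>w v\<bar>) \<le> (\<Sum>v\<in>C'. \<Sum>k<d. r * \<bar>c k v\<bar>)"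
    proof (intro sum_mono)
      fix v
      have "\<bar>w v\<bar> \<le> (\<Sum>k<d. \<bar>(x - b) k * c k v\<bar>)" unfolding w_def by (rule sum_abs)
      also have "\<dots> \<le> (\<Sum>k<d. r * \<bar>c k v\<bar>)"
        using xb by (intro sum_mono) (auto simp: abs_mult intro: mult_right_mono)
      finally show "\<bar>w v\<bar> \<le> (\<Sum>k<d. r * \<bar>c k v\<bar>)" .
    qed
    also have "\<dots> = r * (M - 1)"
      by (simp add: M_def sum_distrib_left) (rule sum.swap)
    also have "\<dots> \<le> r * M" using r by simp
    also have "\<dots> = 1 / N" using M by (simp add: r_def)
    finally have w: "(\<Sum>v\<in>C'. \<bar>w v\<bar>) \<le> 1 / N" .
    have w1: "\<bar>w v\<bar> \<le> 1 / N" if "v \<in> C'" for v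
      using member_le_sum[of v C' "\<lambda>v. \<bar>w v\<bar>"] that C'(1) w by simp
    define u where "u v = (if v = v0 then 1 - (\<Sum>v\<in>C'. 1 / N + w v) else 1 / N + w v)" for v
    have uC': "(\<Sum>v\<in>C'. u v *\<^sub>R f v) = (\<Sum>v\<in>C'. (1 / N + w v) *\<^sub>R f v)" for f :: "point \<Rightarrow> point"
      using C'(3) by (intro sum.cong) (auto simp: u_def)
    have uC: "sum u C' = (\<Sum>v\<in>C'. 1 / N + w v)"
      using C'(3) by (intro sum.cong) (auto simp: u_def)
    have "(\<Sum>v\<in>C'. 1 / N + w v) \<le> d / N + 1 / N"
      using w C'(2) sum_abs_ge_zero order_trans[OF abs_ge_self[of "sum w C'"] order_trans[OF sum_abs w]]
      by (simp add: sum.distrib)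
    also have "\<dots> = 1" by (simp add: N_def add_divide_distrib[symmetric])
    finally have sum_le: "(\<Sum>v\<in>C'. 1 / N + w v) \<le> 1" .
    have "u v \<ge> 0" if "v \<in> C" for v
      using sum_le w1[of v] that C'(4) by (auto simp: u_def abs_le_iff)
    moreover have "sum u C = 1"
      using C'(1,3) uC by (subst C'(4)) (simp add: u_def[of v0])
    moreover have "(\<Sum>v\<in>C. u v *\<^sub>R v) = x"
      using C'(1,3) uC'[of "\<lambda>v. v"] unfolding C'(4) x_eq
      by (simp add: u_def[of v0] scaleR_diff_left scaleR_diff_right sum_subtractf scaleR_sum_left)
    ultimately show "x \<in> convex hull C"
      unfolding convex_hull_finite[OF finC] by blast
  qed
  then show ?thesis using r bR by blast
qed

lemma denom_convex_combination:
  assumes "finite S" "sum u S = 1"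
  shows "denom d q y (\<Sum>v\<in>S. u v *\<^sub>R v) = (\<Sum>v\<in>S. u v * denom d q y v)"
proof -
  have "(\<Sum>v\<in>S. u v * denom d q y v) =
      (\<Sum>v\<in>S. u v) - (\<Sum>v\<in>S. \<Sum>i<d. y i * (u v * v i)) + (\<Sum>v\<in>S. u v * (\<Sum>i<d. y i * q i))"
    by (simp add: denom_def right_diff_distrib sum_subtractf sum.distrib sum_distrib_left algebra_simps)
  also have "(\<Sum>v\<in>S. \<Sum>i<d. y i * (u v * v i)) = (\<Sum>i<d. y i * (\<Sum>v\<in>S. u v * v i))"
    by (subst sum.swap) (simp add: sum_distrib_left)
  also have "(\<Sum>v\<in>S. u v * (\<Sum>i<d. y i * q i)) = (\<Sum>i<d. y i * q i)"
    using assms(2) by (simp add: sum_distrib_right[symmetric])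
  finally show ?thesis
    using assms(2) by (simp add: denom_def sum_point_apply scaleR_fun_def right_diff_distrib sum_subtractf)
qed

lemma denom_segment:
  "denom d q y (\<lambda>i. (1 - s) * a i + s * x i) = (1 - s) * denom d q y a + s * denom d q y x"
proof -
  have "(\<Sum>i<d. y i * ((1 - s) * a i + s * x i - q i)) =
    (\<Sum>i<d. (1 - s) * (y i * (a i - q i)) + s * (y i * (x i - q i)))"
    by (intro sum.cong) (auto simp: algebra_simps)
  also have "\<dots> = (1 - s) * (\<Sum>i<d. y i * (a i - q i)) + s * (\<Sum>i<d. y i * (x i - q i))"
    by (simp only: sum.distrib sum_distrib_left)
  finally show ?thesis
    unfolding denom_def by (simp add: left_diff_distrib right_diff_distrib)
qed

text \<open>
  The same convex combination represents all values of affine functionals at \<open>p\<close>; every lemma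
  below on \<open>denom\<close> over a convex hull follows from this form with positive weights.
\<close>

lemma hull_pointE:
  assumes "p \<in> convex hull K"
  obtains S u where "finite S" "S \<subseteq> K" "\<And>v. v \<in> S \<Longrightarrow> u v > 0" "S \<noteq> {}"
    "\<And>d q y. denom d q y p = (\<Sum>v\<in>S. u v * denom d q y v)"
proof -
  obtain S u where S: "finite S" "S \<subseteq> K" "\<And>v. v \<in> S \<Longrightarrow> u v \<ge> 0" "sum u S = 1" "(\<Sum>v\<in>S. u v *\<^sub>R v) = p"
    using assms unfolding convex_hull_explicit by blast
  define S' where "S' = {v \<in> S. u v > 0}"
  have 1: "(\<Sum>v\<in>S'. u v * f v) = (\<Sum>v\<in>S. u v * f v)" for f
    using S(1,3) by (intro sum.mono_neutral_left) (fastforce simp: S'_def)+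
  have "S' \<noteq> {}" using 1[of "\<lambda>_. 1"] S(4) by auto
  moreover have "denom d q y p = (\<Sum>v\<in>S'. u v * denom d q y v)" for d q y
    unfolding 1 using denom_convex_combination[OF S(1,4), of d q y] unfolding S(5) .
  moreover have "finite S'" "S' \<subseteq> K" "\<And>v. v \<in> S' \<Longrightarrow> u v > 0"
    using S(1,2) by (auto simp: S'_def)
  ultimately show ?thesis by (intro that[of S' u])
qed

lemma denom_pos_hull:
  assumes "\<And>x. x \<in> K \<Longrightarrow> denom d q y x > 0" "p \<in> convex hull K"
  shows "denom d q y p > 0"
  using assms(2)
proof (rule hull_pointE)
  fix S u assume S: "finite S" "S \<subseteq> K" "\<And>v. v \<in> S \<Longrightarrow> u v > (0::real)" "S \<noteq> {}"
    "\<And>d q y. denom d q y p = (\<Sum>v\<in>S. u v * denom d q y v)"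
  show ?thesis unfolding S(5) using S assms(1) by (intro sum_pos) auto
qed

lemma denom_nonneg_hull:
  assumes "\<And>x. x \<in> K \<Longrightarrow> denom d q y x \<ge> 0" "p \<in> convex hull K"
  shows "denom d q y p \<ge> 0"
  using assms(2)
proof (rule hull_pointE)
  fix S u assume S: "finite S" "S \<subseteq> K" "\<And>v. v \<in> S \<Longrightarrow> u v > (0::real)" "S \<noteq> {}"
    "\<And>d q y. denom d q y p = (\<Sum>v\<in>S. u v * denom d q y v)"
  have "0 \<le> u v * denom d q y v" if "v \<in> S" for v
    using S(3)[OF that] assms(1)[of v] S(2) that by (auto intro: mult_nonneg_nonneg)
  then show ?thesis unfolding S(5) by (rule sum_nonneg)
qed

text \<open>
  The face of \<open>conv K\<close> in the support hyperplane \<open>denom d q y0 x = 0\<close> is the convex hull of its points in \<open>K\<close>. The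
  constant \<open>c\<close>, the weight of \<open>x\<close> in a convex combination for \<open>p\<close>, does not depend on \<open>y\<close>.
\<close>

lemma denom_zero_hull:
  assumes nonneg: "\<And>x. x \<in> K \<Longrightarrow> denom d q y0 x \<ge> 0" and p: "p \<in> convex hull K" "denom d q y0 p = 0"
  obtains x c where "x \<in> K" "denom d q y0 x = 0" "c > 0"
    "\<And>y. (\<And>x. x \<in> K \<Longrightarrow> denom d q y x \<ge> 0) \<Longrightarrow> c * denom d q y x \<le> denom d q y p"
  using p(1)
proof (rule hull_pointE)
  fix S u assume S: "finite S" "S \<subseteq> K" "\<And>v. v \<in> S \<Longrightarrow> u v > (0::real)" "S \<noteq> {}"
    "\<And>d q y. denom d q y p = (\<Sum>v\<in>S. u v * denom d q y v)"
  have term_le: "u v * denom d q y v \<le> denom d q y p"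
    if "v \<in> S" "\<And>x. x \<in> K \<Longrightarrow> denom d q y x \<ge> 0" for v y
  proof -
    have "u w * denom d q y w \<ge> 0" if "w \<in> S - {v}" for w
      using S(3)[of w] \<open>\<And>x. x \<in> K \<Longrightarrow> denom d q y x \<ge> 0\<close>[of w] S(2) that by (auto intro: mult_nonneg_nonneg)
    then show ?thesis
      unfolding S(5) by (rule member_le_sum[where f = "\<lambda>v. u v * denom d q y v", OF \<open>v \<in> S\<close> _ S(1)])
  qed
  obtain v where v: "v \<in> S" using S(4) by blast
  have "denom d q y0 v \<le> 0"
    using term_le[OF v nonneg] p(2) S(3)[OF v] by (simp add: mult_le_0_iff)
  moreover have "denom d q y0 v \<ge> 0" using v S(2) nonneg by blast
  ultimately have "denom d q y0 v = 0" by (rule order_antisym)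
  then show ?thesis
  proof (rule that[rotated])
    show "v \<in> K" using v S(2) by blast
    show "u v > 0" using v by (rule S(3))
  qed (rule term_le[OF v])
qed

lemma hull_subset_R_space: "K \<subseteq> R_space d \<Longrightarrow> convex hull K \<subseteq> R_space d"
  by (rule hull_minimal)
    (auto simp: convex_def R_space_iff plus_fun_def scaleR_fun_def)

lemma denom_cube_corner:
  assumes "k < d" "r \<ge> 0" "x \<in> R_space d"
  obtains x' where "x' \<in> cube d x r" "denom d q y x' = denom d q y x - r * \<bar>y k\<bar>"
proof
  let ?x = "x(k := x k + r * sgn (y k))"
  have "\<bar>r * sgn (y k)\<bar> \<le> r"
    using assms(2) by (simp add: abs_mult abs_sgn_eq)
  then show "?x \<in> cube d x r"
    using assms by (simp add: cube_def R_space_iff)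
  have "(\<Sum>i<d. y i * (?x i - q i)) = (\<Sum>i<d. y i * (x i - q i) + (if i = k then r * \<bar>y k\<bar> else 0))"
    by (intro sum.cong refl) (simp add: right_diff_distrib distrib_left abs_sgn)
  then show "denom d q y ?x = denom d q y x - r * \<bar>y k\<bar>"
    using assms by (simp add: denom_def sum.distrib)
qed

text \<open>
  A point in the interior of the hull could be moved so that the nonnegative functional \<open>denom d q y\<close>
  becomes negative.
\<close>

lemma denom_zero_frontier:
  assumes K: "K \<subseteq> R_space d" and nonneg: "\<And>x. x \<in> K \<Longrightarrow> denom d q y x \<ge> 0"
    and x: "x \<in> K" "denom d q y x = 0"
  shows "x \<in> Euclidean_space d frontier_of (convex hull K)"
proof -
  have sub: "convex hull K \<subseteq> R_space d" using K by (rule hull_subset_R_space)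
  have xh: "x \<in> convex hull K" using x(1) by (rule hull_inc)
  have "x \<notin> Euclidean_space d interior_of (convex hull K)"
  proof
    assume "x \<in> Euclidean_space d interior_of (convex hull K)"
    then obtain U where U: "openin (Euclidean_space d) U" "x \<in> U" "U \<subseteq> convex hull K"
      by (auto simp: interior_of_def)
    obtain r where r: "r > 0" "cube d x r \<subseteq> U"
      using openin_Euclidean_space_cube[OF U(1,2)] by blast
    have "\<exists>k<d. y k \<noteq> 0"
    proof (rule ccontr)
      assume "\<not> (\<exists>k<d. y k \<noteq> 0)"
      then have "denom d q y x = 1" by (simp add: denom_def)
      then show False using x(2) by simp
    qed
    then obtain k where k: "k < d" "y k \<noteq> 0" by blast
    obtain x' where x': "x' \<in> cube d x r" "denom d q y x' = denom d q y x - r * \<bar>y k\<bar>"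
      using denom_cube_corner[of k d r x q y] k(1) r(1) x(1) K by auto
    have "denom d q y x' < 0" using x'(2) x(2) r(1) k(2) by simp
    moreover have "x' \<in> convex hull K" using x'(1) r(2) U(3) by blast
    ultimately show False using denom_nonneg_hull[OF nonneg] by fastforce
  qed
  moreover have "x \<in> Euclidean_space d closure_of (convex hull K)"
    using closure_of_subset[of "convex hull K" "Euclidean_space d"] sub xh by blast
  ultimately show ?thesis by (simp add: frontier_of_def)
qed

section \<open>The polar body and the volume of projective images\<close>

lemma compact_cube: "compact (cube d q r)"
proof -
  have "cube d q r = R_space d \<inter> Pi\<^sub>E UNIV (\<lambda>i. if i < d then {q i - r..q i + r} else {0})"
  proof (intro set_eqI iffI)
    fix x assume "x \<in> cube d q r"
    then show "x \<in> R_space d \<inter> Pi\<^sub>E UNIV (\<lambda>i. if i < d then {q i - r..q i + r} else {0})"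
      by (auto simp: cube_def R_space_iff PiE_iff abs_le_iff algebra_simps)
  next
    fix x assume x: "x \<in> R_space d \<inter> Pi\<^sub>E UNIV (\<lambda>i. if i < d then {q i - r..q i + r} else {0})"
    then have "x i \<in> (if i < d then {q i - r..q i + r} else {0})" for i
      by (simp add: PiE_iff)
    then have "x i \<in> {q i - r..q i + r}" if "i < d" for i
      using that by (metis (full_types))
    then have "\<bar>x i - q i\<bar> \<le> r" if "i < d" for i
      using that by (force simp: abs_le_iff)
    then show "x \<in> cube d q r" using x by (simp add: cube_def)
  qed
  moreover have "compactin (product_topology (\<lambda>_::nat. euclidean::real topology) UNIV)
      (Pi\<^sub>E UNIV (\<lambda>i. if i < d then {q i - r..q i + r} else {0}))"
    by (subst compactin_PiE) auto
  then have "compact (Pi\<^sub>E UNIV (\<lambda>i. if i < d then {q i - r..q i + r} else {0}))"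
    by (simp add: euclidean_product_topology)
  ultimately show ?thesis
    using compact_Int_closed[OF _ closed_R_space] by (metis Int_commute)
qed

lemma tendsto_coordinate: "(X \<longlongrightarrow> (x::point)) F \<Longrightarrow> ((\<lambda>n. X n i) \<longlongrightarrow> x i) F"
  by (rule continuous_on_tendsto_compose[where s = UNIV and f = "\<lambda>x. x i"])
    (auto intro: continuous_on_product_coordinates)

lemma denom_le_hull:
  assumes "\<And>x. x \<in> K \<Longrightarrow> denom d q y x \<le> c * denom d q y' x" "p \<in> convex hull K"
  shows "denom d q y p \<le> c * denom d q y' p"
  using assms(2)
proof (rule hull_pointE)
  fix S u assume S: "finite S" "S \<subseteq> K" "\<And>v. v \<in> S \<Longrightarrow> u v > (0::real)" "S \<noteq> {}"
    "\<And>d q y. denom d q y p = (\<Sum>v\<in>S. u v * denom d q y v)"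
  have "u v * denom d q y v \<le> c * (u v * denom d q y' v)" if "v \<in> S" for v
    using mult_left_mono[OF assms(1)[of v] less_imp_le[OF S(3)[OF that]]] S(2) that
    by (auto simp: mult_ac)
  then show ?thesis unfolding S(5) sum_distrib_left by (rule sum_mono)
qed

locale pointed_body =
  fixes d :: nat and K :: "point set" and q :: point and r :: real
  assumes compact_K: "compact K" and K_sub: "K \<subseteq> R_space d"
    and q_in: "q \<in> R_space d" and r_pos: "r > 0" and cube_sub: "cube d q r \<subseteq> K"
begin

definition polar_interior :: "point set"
  where "polar_interior = {y \<in> R_space d. \<forall>x\<in>K. denom d q y x > 0}"

definition polar :: "point set"
  where "polar = {y \<in> R_space d. \<forall>x\<in>K. denom d q y x \<ge> 0}"

definition proj_volume :: "point \<Rightarrow> real"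
  where "proj_volume y = enn2real (\<integral>\<^sup>+x\<in>K. ennreal (inverse (denom d q y x ^ (d + 1))) \<partial>lborel_space d)"

lemma K_borel [measurable]: "K \<in> sets borel"
  using compact_K by (intro borel_closed compact_imp_closed)

lemma q_in_K: "q \<in> K"
  using cube_sub q_in r_pos by (auto simp: cube_def)

lemma K_bounded: "\<exists>B>0. \<forall>x\<in>K. \<forall>i<d. \<bar>x i - q i\<bar> \<le> B"
proof -
  have "compact ((\<lambda>x. \<Sum>i<d. \<bar>x i - q i\<bar>) ` K)"
    by (intro compact_continuous_image compact_K continuous_intros
        continuous_on_subset[OF continuous_on_product_coordinates]) auto
  then obtain B where B: "\<And>x. x \<in> K \<Longrightarrow> (\<Sum>i<d. \<bar>x i - q i\<bar>) \<le> B"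
    by (force dest!: compact_imp_bounded simp: bounded_iff)
  have "\<bar>x i - q i\<bar> \<le> max B 1" if "x \<in> K" "i < d" for x i
    using member_le_sum[of i "{..<d}" "\<lambda>i. \<bar>x i - q i\<bar>"] B[OF that(1)] that(2) by auto
  then show ?thesis by (intro exI[of _ "max B 1"]) auto
qed

text \<open>
  A bound for \<open>K\<close> in the maximum norm around \<open>q\<close>, fixed once because the estimates on the whole polar body
  share it.
\<close>

definition radius :: real
  where "radius = (SOME B. B > 0 \<and> (\<forall>x\<in>K. \<forall>i<d. \<bar>x i - q i\<bar> \<le> B))"

lemma radius_pos: "radius > 0" and radius_bound: "x \<in> K \<Longrightarrow> i < d \<Longrightarrow> \<bar>x i - q i\<bar> \<le> radius"
  using someI_ex[OF K_bounded] unfolding radius_def by auto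

lemma emeasure_K_finite: "emeasure (lborel_space d) K < \<infinity>"
proof -
  have "K \<subseteq> cube d q radius"
    using K_sub radius_bound by (auto simp: cube_def)
  then have "emeasure (lborel_space d) K \<le> emeasure (lborel_space d) (cube d q radius)"
    by (intro emeasure_mono) auto
  then show ?thesis
    using radius_pos by (simp add: emeasure_cube) (metis ennreal_less_top le_less_trans)
qed

lemma denom_diff_le:
  assumes "x \<in> K"
  shows "\<bar>denom d q y x - denom d q y' x\<bar> \<le> (\<Sum>i<d. \<bar>y i - y' i\<bar>) * radius"
proof -
  have "denom d q y x - denom d q y' x = (\<Sum>i<d. (y' i - y i) * (x i - q i))"
    by (simp add: denom_def sum_subtractf[symmetric] left_diff_distrib)
  also have "\<bar>\<dots>\<bar> \<le> (\<Sum>i<d. \<bar>(y' i - y i) * (x i - q i)\<bar>)"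
    by (rule sum_abs)
  also have "\<dots> \<le> (\<Sum>i<d. \<bar>y i - y' i\<bar> * radius)"
    using radius_bound[OF assms]
    by (intro sum_mono) (auto simp: abs_mult abs_minus_commute intro: mult_left_mono)
  finally show ?thesis by (simp add: sum_distrib_right)
qed

lemma polar_bounded:
  assumes "y \<in> polar" "k < d"
  shows "\<bar>y k\<bar> \<le> 1 / r"
proof -
  obtain x' where x': "x' \<in> cube d q r" "denom d q y x' = denom d q y q - r * \<bar>y k\<bar>"
    using denom_cube_corner[of k d r q q y] assms(2) r_pos q_in by auto
  have "denom d q y x' \<ge> 0" using x'(1) cube_sub assms(1) by (auto simp: polar_def)
  then show ?thesis using x'(2) r_pos by (simp add: denom_def field_simps)
qed

lemma interior_subset_polar: "polar_interior \<subseteq> polar"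
  by (auto simp: polar_def polar_interior_def intro: less_imp_le)

definition denom_bound :: real
  where "denom_bound = 1 + real d / r * radius"

lemma denom_bound_pos: "denom_bound > 0"
  using r_pos radius_pos by (simp add: denom_bound_def add_pos_nonneg)

lemma denom_le_bound:
  assumes "y \<in> polar" "x \<in> K"
  shows "denom d q y x \<le> denom_bound"
proof -
  have "denom d q y x \<le> 1 + (\<Sum>i<d. \<bar>y i\<bar>) * radius"
    using denom_diff_le[OF assms(2), of y "\<lambda>_. 0"] by (simp add: denom_def)
  also have "(\<Sum>i<d. \<bar>y i\<bar>) \<le> (\<Sum>i<d. 1 / r)"
    using polar_bounded[OF assms(1)] by (intro sum_mono) auto
  then have "(\<Sum>i<d. \<bar>y i\<bar>) * radius \<le> real d / r * radius"
    using radius_pos by (intro mult_right_mono) auto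
  finally show ?thesis by (simp add: denom_bound_def)
qed

lemma compact_polar: "compact polar"
proof -
  have "closed {y::point. denom d q y x \<ge> 0}" for x
    unfolding denom_def
    by (intro closed_Collect_le continuous_intros continuous_on_product_coordinates)
  then have "closed (\<Inter>x\<in>K. {y::point. denom d q y x \<ge> 0})" by auto
  then have "compact (cube d (\<lambda>_. 0) (1 / r) \<inter> (\<Inter>x\<in>K. {y. denom d q y x \<ge> 0}))"
    by (intro compact_Int_closed compact_cube)
  moreover have "cube d (\<lambda>_. 0) (1 / r) \<inter> (\<Inter>x\<in>K. {y. denom d q y x \<ge> 0}) = polar"
    using polar_bounded by (auto simp: cube_def) (auto simp: polar_def)
  ultimately show ?thesis by simp
qed

lemma denom_lower_bound:
  assumes "y \<in> polar_interior"
  shows "\<exists>\<eta>>0. \<forall>x\<in>K. denom d q y x \<ge> \<eta>"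
proof -
  obtain x where "x \<in> K" "\<forall>x'\<in>K. denom d q y x \<le> denom d q y x'"
    using continuous_attains_inf[OF compact_K _ continuous_on_denom] q_in_K by blast
  then show ?thesis using assms by (auto simp: polar_interior_def)
qed

lemma proj_volume_finite:
  assumes "y \<in> polar_interior"
  shows "(\<integral>\<^sup>+x\<in>K. ennreal (inverse (denom d q y x ^ (d + 1))) \<partial>lborel_space d) = ennreal (proj_volume y)"
proof -
  obtain \<eta> where \<eta>: "\<eta> > 0" "\<And>x. x \<in> K \<Longrightarrow> denom d q y x \<ge> \<eta>"
    using denom_lower_bound[OF assms] by blast
  have "(\<integral>\<^sup>+x\<in>K. ennreal (inverse (denom d q y x ^ (d + 1))) \<partial>lborel_space d)
      \<le> (\<integral>\<^sup>+x\<in>K. ennreal (inverse (\<eta> ^ (d + 1))) \<partial>lborel_space d)"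
    using \<eta> by (intro nn_integral_mono)
      (auto simp: indicator_def intro!: ennreal_leI le_imp_inverse_le power_mono simp del: power_Suc)
  also have "\<dots> = ennreal (inverse (\<eta> ^ (d + 1))) * emeasure (lborel_space d) K"
    by (subst nn_integral_cmult_indicator) auto
  also have "\<dots> < \<infinity>"
    using emeasure_K_finite by (simp add: ennreal_mult_less_top)
  finally show ?thesis by (simp add: proj_volume_def)
qed

lemma proj_volume_pos:
  assumes "y \<in> polar_interior"
  shows "proj_volume y > 0"
proof -
  have "ennreal (inverse (denom_bound ^ (d + 1)) * (2 * r) ^ d)
     = (\<integral>\<^sup>+x\<in>cube d q r. ennreal (inverse (denom_bound ^ (d + 1))) \<partial>lborel_space d)"
    using denom_bound_pos r_pos
    by (subst nn_integral_cmult_indicator) (auto simp: emeasure_cube ennreal_mult')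
  also have "\<dots> \<le> (\<integral>\<^sup>+x\<in>K. ennreal (inverse (denom d q y x ^ (d + 1))) \<partial>lborel_space d)"
  proof (intro nn_integral_mono)
    fix x
    have "inverse (denom_bound ^ (d + 1)) \<le> inverse (denom d q y x ^ (d + 1))" if "x \<in> K"
      using that assms denom_le_bound[of y x] interior_subset_polar
      by (intro le_imp_inverse_le power_mono zero_less_power)
        (auto simp: polar_interior_def intro: less_imp_le)
    then show "ennreal (inverse (denom_bound ^ (d + 1))) * indicator (cube d q r) x
        \<le> ennreal (inverse (denom d q y x ^ (d + 1))) * indicator K x"
      using cube_sub by (auto simp: indicator_def intro!: ennreal_leI)
  qed
  also have "\<dots> = ennreal (proj_volume y)" by (rule proj_volume_finite[OF assms])
  finally have "inverse (denom_bound ^ (d + 1)) * (2 * r) ^ d \<le> proj_volume y"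
    by (simp add: ennreal_le_iff proj_volume_def)
  moreover have "inverse (denom_bound ^ (d + 1)) * (2 * r) ^ d > 0"
    using denom_bound_pos r_pos by simp
  ultimately show ?thesis by linarith
qed

lemma proj_volume_le_scaled:
  assumes y: "y \<in> polar_interior" "y' \<in> polar_interior" and c: "c > 0"
    and le: "\<And>x. x \<in> K \<Longrightarrow> denom d q y' x \<le> c * denom d q y x"
  shows "proj_volume y \<le> c ^ (d + 1) * proj_volume y'"
proof -
  have "ennreal (proj_volume y) = (\<integral>\<^sup>+x\<in>K. ennreal (inverse (denom d q y x ^ (d + 1))) \<partial>lborel_space d)"
    by (simp only: proj_volume_finite[OF y(1)])
  also have "\<dots> \<le> (\<integral>\<^sup>+x. ennreal (c ^ (d + 1)) *
      (ennreal (inverse (denom d q y' x ^ (d + 1))) * indicator K x) \<partial>lborel_space d)"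
  proof (intro nn_integral_mono)
    fix x
    have "inverse (denom d q y x ^ (d + 1)) \<le> c ^ (d + 1) * inverse (denom d q y' x ^ (d + 1))" if x: "x \<in> K"
    proof -
      have pos: "denom d q y x > 0" "denom d q y' x > 0"
        using x y by (auto simp: polar_interior_def)
      have "denom d q y' x ^ (d + 1) \<le> (c * denom d q y x) ^ (d + 1)"
        using le[OF x] pos by (intro power_mono) auto
      then show ?thesis using pos c by (simp add: power_mult_distrib field_simps del: power_Suc)
    qed
    then show "ennreal (inverse (denom d q y x ^ (d + 1))) * indicator K x \<le> ennreal (c ^ (d + 1)) *
      (ennreal (inverse (denom d q y' x ^ (d + 1))) * indicator K x)"
      using c by (auto simp: indicator_def ennreal_mult'[symmetric] simp del: power_Suc intro!: ennreal_leI)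
  qed
  also have "\<dots> = ennreal (c ^ (d + 1)) * ennreal (proj_volume y')"
    by (subst nn_integral_cmult) (auto simp: proj_volume_finite[OF y(2), simplified])
  also have "\<dots> = ennreal (c ^ (d + 1) * proj_volume y')"
    using c by (simp add: ennreal_mult')
  finally show ?thesis
    using proj_volume_pos[OF y(2)] c by (subst (asm) ennreal_le_iff) auto
qed

text \<open>
  Shrink a cube inside the simplex towards its vertex \<open>x0\<close> by the factor \<open>s = denom d q y x0 / M\<close>, where
  \<open>M\<close> bounds all denominators. It stays in the simplex, and on it the denominator is at most
  \<open>2 * denom d q y x0\<close>. So the integral is at least of order \<open>s\<^sup>d\<close> times
  \<open>denom d q y x0\<close> to the power \<open>-(d + 1)\<close>, which is of order \<open>1 / denom d q y x0\<close>.
\<close>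

lemma proj_volume_ge_at_cusp_free_point:
  assumes cf: "cusp_free d K" and x0: "x0 \<in> K" "x0 \<in> Euclidean_space d frontier_of (convex hull K)"
  shows "\<exists>c>0. \<forall>y\<in>polar_interior. c / denom d q y x0 \<le> proj_volume y"
proof -
  obtain C where C: "\<not> affine_dependent C" "card C = d + 1" "x0 \<in> C" "convex hull C \<subseteq> K"
    using cf x0 unfolding cusp_free_def by blast
  have "C \<subseteq> R_space d" using C(4) K_sub hull_subset[of C convex] by blast
  then obtain b \<rho> where b: "\<rho> > 0" "b \<in> R_space d" "cube d b \<rho> \<subseteq> convex hull C"
    using simplex_contains_cube[OF C(1,2)] by blast
  define M where "M = denom_bound"
  have M: "M > 0" unfolding M_def by (rule denom_bound_pos)
  define c where "c = (2 * \<rho>) ^ d / (M ^ d * 2 ^ (d + 1))"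
  have "c / denom d q y x0 \<le> proj_volume y" if y: "y \<in> polar_interior" for y
  proof -
    define l where "l = denom d q y x0"
    have pos: "\<And>x. x \<in> K \<Longrightarrow> denom d q y x > 0" using y by (auto simp: polar_interior_def)
    have le: "\<And>x. x \<in> K \<Longrightarrow> denom d q y x \<le> M"
      using y interior_subset_polar denom_le_bound by (auto simp: M_def)
    have l: "l > 0" "l \<le> M" using pos le x0(1) by (auto simp: l_def)
    define s where "s = l / M"
    have s: "0 < s" "s \<le> 1" using l M by (auto simp: s_def)
    define T where "T x = (\<lambda>i. (1 - s) * x0 i + s * x i)" for x :: point
    have T [measurable]: "T \<in> borel \<rightarrow>\<^sub>M (borel :: point measure)"
      unfolding T_def by (rule measurable_coordinatewise_then_product) measurable
    define F where "F x = ennreal (inverse (denom d q y x ^ (d + 1))) * indicator K x" for x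
    have [measurable]: "F \<in> borel_measurable borel" unfolding F_def by measurable
    have T_in: "T x \<in> K" if "x \<in> cube d b \<rho>" for x
    proof -
      have "(1 - s) *\<^sub>R x0 + s *\<^sub>R x \<in> convex hull C"
        using that b(3) hull_inc[OF C(3), of convex] s
        by (intro convexD[OF convex_convex_hull]) auto
      also have "(1 - s) *\<^sub>R x0 + s *\<^sub>R x = T x"
        by (simp add: T_def plus_fun_def scaleR_fun_def)
      finally show ?thesis using C(4) by blast
    qed
    have F_ge: "ennreal (inverse ((2 * l) ^ (d + 1))) * indicator (cube d b \<rho>) x \<le> F (T x)" for x
    proof (cases "x \<in> cube d b \<rho>")
      case True
      have "denom d q y (T x) = (1 - s) * l + s * denom d q y x"
        unfolding T_def denom_segment l_def ..
      also have "\<dots> \<le> 1 * l + s * M"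
        using s l le[of x] True b(3) C(4) by (intro add_mono mult_right_mono mult_left_mono) auto
      also have "\<dots> = 2 * l" using M by (simp add: s_def)
      finally have "inverse ((2 * l) ^ (d + 1)) \<le> inverse (denom d q y (T x) ^ (d + 1))"
        using pos[OF T_in[OF True]] l by (intro le_imp_inverse_le power_mono zero_less_power) auto
      then show ?thesis using True T_in[OF True] by (simp add: F_def ennreal_leI del: power_Suc)
    qed simp
    have "ennreal (s ^ d * (inverse ((2 * l) ^ (d + 1)) * (2 * \<rho>) ^ d)) =
      ennreal (s ^ d) * (\<integral>\<^sup>+x. ennreal (inverse ((2 * l) ^ (d + 1))) * indicator (cube d b \<rho>) x \<partial>lborel_space d)"
      using s l b(1) by (subst nn_integral_cmult_indicator) (auto simp: emeasure_cube ennreal_mult' simp del: power_Suc)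
    also have "\<dots> \<le> ennreal (s ^ d) * (\<integral>\<^sup>+x. F (T x) \<partial>lborel_space d)"
      by (intro mult_left_mono nn_integral_mono F_ge) auto
    also have "\<dots> = (\<integral>\<^sup>+x. F x \<partial>lborel_space d)"
      unfolding T_def using s x0(1) K_sub
      by (intro nn_integral_lborel_space_affine[symmetric]) (auto simp: R_space_iff)
    also have "\<dots> = ennreal (proj_volume y)"
      unfolding F_def by (rule proj_volume_finite[OF y])
    finally have "s ^ d * (inverse ((2 * l) ^ (d + 1)) * (2 * \<rho>) ^ d) \<le> proj_volume y"
      using proj_volume_pos[OF y] by (subst (asm) ennreal_le_iff) auto
    moreover have "s ^ d * (inverse ((2 * l) ^ (d + 1)) * (2 * \<rho>) ^ d) = c / l"
      using l M by (simp add: s_def c_def power_divide power_mult_distrib field_simps)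
    ultimately show ?thesis unfolding l_def[symmetric] by linarith
  qed
  moreover have "c > 0" using M b(1) by (simp add: c_def)
  ultimately show ?thesis by blast
qed

end

section \<open>Existence of a minimiser\<close>

context pointed_body
begin

lemma proj_volume_ge_at_hull_point:
  assumes cf: "cusp_free d K" and y0: "y0 \<in> polar" and p: "p \<in> convex hull K" "denom d q y0 p = 0"
  shows "\<exists>a>0. \<forall>y\<in>polar_interior. a / proj_volume y \<le> denom d q y p"
proof -
  have nonneg: "\<And>x. x \<in> K \<Longrightarrow> denom d q y0 x \<ge> 0" using y0 by (auto simp: polar_def)
  obtain x c where x: "x \<in> K" "denom d q y0 x = 0" "c > 0"
    "\<And>y. (\<And>x. x \<in> K \<Longrightarrow> denom d q y x \<ge> 0) \<Longrightarrow> c * denom d q y x \<le> denom d q y p"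
    using denom_zero_hull[OF nonneg p] by metis
  have "x \<in> Euclidean_space d frontier_of (convex hull K)"
    by (rule denom_zero_frontier[OF K_sub nonneg x(1,2)])
  then obtain b where b: "b > 0" "\<And>y. y \<in> polar_interior \<Longrightarrow> b / denom d q y x \<le> proj_volume y"
    using proj_volume_ge_at_cusp_free_point[OF cf x(1)] by blast
  have "c * b / proj_volume y \<le> denom d q y p" if y: "y \<in> polar_interior" for y
  proof -
    have pos: "denom d q y x > 0" "proj_volume y > 0"
      using y x(1) proj_volume_pos by (auto simp: polar_interior_def)
    have "c * b / proj_volume y = c * (b / proj_volume y)" by simp
    also have "b / proj_volume y \<le> denom d q y x"
      using b(2)[OF y] pos by (simp add: field_simps)
    then have "c * (b / proj_volume y) \<le> c * denom d q y x"
      using x(3) by (intro mult_left_mono) auto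
    also have "\<dots> \<le> denom d q y p"
      using y by (intro x(4)) (auto simp: polar_interior_def intro: less_imp_le)
    finally show ?thesis .
  qed
  moreover have "c * b > 0" using x(3) b(1) by simp
  ultimately show ?thesis by blast
qed

text \<open>
  The exponential of \<open>n (d + 1) F\<close>, where \<open>F y\<close> is \<open>ln (proj_volume y) / (d + 1)\<close> plus the mean of
  \<open>ln (denom d q y (p i))\<close>. The exponents \<open>n\<close> and \<open>d + 1\<close> make it invariant under
  rescaling the denominator by a constant.
\<close>

definition objective :: "nat \<Rightarrow> (nat \<Rightarrow> point) \<Rightarrow> point \<Rightarrow> real"
  where "objective n p y = proj_volume y ^ n * (\<Prod>i=1..n. denom d q y (p i) ^ (d + 1))"

lemma denom_hull_pos:
  assumes "y \<in> polar_interior" "p \<in> convex hull K"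
  shows "denom d q y p > 0"
  using denom_pos_hull[of K d q y p] assms by (auto simp: polar_interior_def)

lemma objective_pos:
  assumes "y \<in> polar_interior" "\<And>i. i \<in> {1..n} \<Longrightarrow> p i \<in> convex hull K"
  shows "objective n p y > 0"
  unfolding objective_def
  by (intro mult_pos_pos zero_less_power prod_pos proj_volume_pos denom_hull_pos assms ballI)

text \<open>
  This is how continuity of the objective is used: functionals that are uniformly close on \<open>K\<close> and
  bounded away from \<open>0\<close> agree up to a factor \<open>c\<close> near \<open>1\<close>.
\<close>

lemma objective_le_scaled:
  assumes y: "y \<in> polar_interior" "y' \<in> polar_interior" and c: "c > 0"
    and p: "\<And>i. i \<in> {1..n} \<Longrightarrow> p i \<in> convex hull K"
    and le: "\<And>x. x \<in> K \<Longrightarrow> denom d q y' x \<le> c * denom d q y x"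
    "\<And>x. x \<in> K \<Longrightarrow> denom d q y x \<le> c * denom d q y' x"
  shows "objective n p y \<le> c ^ (2 * n * (d + 1)) * objective n p y'"
proof -
  have 1: "proj_volume y ^ n \<le> (c ^ (d + 1) * proj_volume y') ^ n"
    using proj_volume_le_scaled[OF y c le(1)] proj_volume_pos[OF y(1)] by (intro power_mono) auto
  have "denom d q y (p i) ^ (d + 1) \<le> c ^ (d + 1) * denom d q y' (p i) ^ (d + 1)" if i: "i \<in> {1..n}" for i
  proof -
    have "denom d q y (p i) \<le> c * denom d q y' (p i)"
      using le(2) p[OF i] by (rule denom_le_hull)
    then have "denom d q y (p i) ^ (d + 1) \<le> (c * denom d q y' (p i)) ^ (d + 1)"
      using denom_hull_pos[OF y(1) p[OF i]] by (intro power_mono) auto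
    then show ?thesis by (simp only: power_mult_distrib)
  qed
  then have "(\<Prod>i=1..n. denom d q y (p i) ^ (d + 1)) \<le> (\<Prod>i=1..n. c ^ (d + 1) * denom d q y' (p i) ^ (d + 1))"
    using denom_hull_pos[OF y(1) p] by (intro prod_mono) (auto intro!: less_imp_le simp del: power_Suc)
  also have "\<dots> = (c ^ (d + 1)) ^ n * (\<Prod>i=1..n. denom d q y' (p i) ^ (d + 1))"
    by (simp add: prod.distrib del: power_Suc)
  finally have 2: "(\<Prod>i=1..n. denom d q y (p i) ^ (d + 1))
      \<le> (c ^ (d + 1)) ^ n * (\<Prod>i=1..n. denom d q y' (p i) ^ (d + 1))" .
  have "objective n p y \<le> (c ^ (d + 1) * proj_volume y') ^ n *
      ((c ^ (d + 1)) ^ n * (\<Prod>i=1..n. denom d q y' (p i) ^ (d + 1)))"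
    unfolding objective_def
    using 1 2 denom_hull_pos[OF y(1) p] proj_volume_pos[OF y(2)] c
    by (intro mult_mono prod_nonneg) (auto intro!: less_imp_le)
  also have "\<dots> = c ^ (2 * n * (d + 1)) * objective n p y'"
  proof -
    have "(c ^ (d + 1)) ^ n * (c ^ (d + 1)) ^ n = c ^ ((d + 1) * n + (d + 1) * n)"
      by (simp only: power_mult power_add)
    also have "(d + 1) * n + (d + 1) * n = 2 * n * (d + 1)" by simp
    finally have eq: "(c ^ (d + 1)) ^ n * (c ^ (d + 1)) ^ n = c ^ (2 * n * (d + 1))" .
    show ?thesis
      unfolding objective_def power_mult_distrib eq[symmetric] by (simp only: mult_ac)
  qed
  finally show ?thesis .
qed

text \<open>
  Take a minimising sequence; by compactness of the polar body a subsequence converges to some \<open>y0\<close>.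
  If \<open>y0\<close> is an interior point it is a minimiser by continuity. If \<open>y0\<close> is a boundary point, then \<open>k\<close> of
  the points lie on the corresponding support hyperplane, each of them has a denominator at least
  \<open>a\<^sub>i / w\<close> for the volume \<open>w\<close> of the projective image, and the other denominators stay away from \<open>0\<close>. So the
  objective is at least a constant times \<open>w\<close> to the power \<open>n - (d + 1) k \<ge> 1\<close>, which is unbounded because
  \<open>w\<close> is; this contradicts minimality.
\<close>

lemma exists_minimizer:
  assumes cf: "cusp_free d K" and p: "\<And>i. i \<in> {1..n} \<Longrightarrow> p i \<in> convex hull K"
    and few: "\<And>y x. y \<in> polar \<Longrightarrow> x \<in> K \<Longrightarrow> denom d q y x = 0 \<Longrightarrow>
      (d + 1) * card {i \<in> {1..n}. denom d q y (p i) = 0} < n"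
  shows "\<exists>y\<in>polar_interior. \<forall>y'\<in>polar_interior. objective n p y \<le> objective n p y'"
proof -
  let ?G = "objective n p"
  define m where "m = Inf (?G ` polar_interior)"
  have zero_in: "(\<lambda>_. 0) \<in> polar_interior"
    by (auto simp: polar_interior_def R_space_iff denom_def)
  have bdd: "bdd_below (?G ` polar_interior)"
    using objective_pos[OF _ p] by (intro bdd_belowI2[of _ 0]) (auto intro: less_imp_le)
  have m_le: "m \<le> ?G y" if "y \<in> polar_interior" for y
    unfolding m_def using that bdd by (intro cINF_lower)
  have "\<exists>y\<in>polar_interior. ?G y < m + 1 / real (Suc k)" for k
    using zero_in bdd cINF_less_iff[of polar_interior ?G "m + 1 / real (Suc k)"]
    by (auto simp: m_def)
  then obtain Y where Y: "\<And>k. Y k \<in> polar_interior" "\<And>k. ?G (Y k) < m + 1 / real (Suc k)"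
    by metis
  have "seq_compact polar" by (rule compact_imp_seq_compact[OF compact_polar])
  then obtain y0 \<sigma> where y0: "y0 \<in> polar" and \<sigma>: "strict_mono \<sigma>" and lim: "(Y \<circ> \<sigma>) \<longlonglongrightarrow> y0"
    using Y(1) interior_subset_polar unfolding seq_compact_def by (metis subsetD)
  define Z where "Z = Y \<circ> \<sigma>"
  have Z: "Z k \<in> polar_interior" "?G (Z k) < m + 1 / real (Suc k)" for k
  proof -
    show "Z k \<in> polar_interior" using Y(1) by (simp add: Z_def)
    have "?G (Z k) < m + 1 / real (Suc (\<sigma> k))" using Y(2) by (simp add: Z_def)
    also have "\<dots> \<le> m + 1 / real (Suc k)"
      using strict_mono_imp_increasing[OF \<sigma>, of k] by (simp add: frac_le)
    finally show "?G (Z k) < m + 1 / real (Suc k)" .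
  qed
  have Zlim: "(\<lambda>k. Z k i) \<longlonglongrightarrow> y0 i" for i
    using tendsto_coordinate[OF lim] by (simp add: Z_def)
  have denom_lim: "(\<lambda>k. denom d q (Z k) x) \<longlonglongrightarrow> denom d q y0 x" for x
    unfolding denom_def by (intro tendsto_intros Zlim)
  show ?thesis
  proof (cases "y0 \<in> polar_interior")
    case True
    obtain \<eta> where \<eta>: "\<eta> > 0" "\<And>x. x \<in> K \<Longrightarrow> denom d q y0 x \<ge> \<eta>"
      using denom_lower_bound[OF True] by blast
    define e where "e k = (\<Sum>i<d. \<bar>Z k i - y0 i\<bar>) * radius" for k
    have "(\<lambda>k. (\<Sum>i<d. \<bar>Z k i - y0 i\<bar>) * radius) \<longlonglongrightarrow> (\<Sum>i<d. \<bar>y0 i - y0 i\<bar>) * radius"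
      by (intro tendsto_intros Zlim)
    then have e: "e \<longlonglongrightarrow> 0" by (simp add: e_def[abs_def])
    have e_nonneg: "e k \<ge> 0" for k using radius_pos by (simp add: e_def sum_nonneg)
    \<comment> \<open>If two functionals differ by at most \<open>e k\<close> and are at least \<open>\<eta> / 2\<close>, their ratio is at most
      \<open>\<rho> k\<close> in both directions.\<close>
    define \<rho> where "\<rho> k = 1 + 2 * e k / \<eta>" for k
    have "(\<lambda>k. 1 + 2 * e k / \<eta>) \<longlonglongrightarrow> 1 + 2 * 0 / \<eta>"
      using \<eta>(1) by (intro tendsto_intros e) auto
    then have \<rho>: "\<rho> \<longlonglongrightarrow> 1" by (simp add: \<rho>_def[abs_def])
    have "eventually (\<lambda>k. e k < \<eta> / 2) sequentially"
      using order_tendstoD(2)[OF e, of "\<eta> / 2"] \<eta>(1) by simp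
    then have ev: "eventually (\<lambda>k. ?G y0 \<le> \<rho> k ^ (2 * n * (d + 1)) * (m + 1 / real (Suc k))) sequentially"
    proof eventually_elim
      fix k assume k: "e k < \<eta> / 2"
      have \<rho>1: "\<rho> k \<ge> 1" using e_nonneg[of k] \<eta>(1) by (simp add: \<rho>_def)
      have "denom d q (Z k) x \<le> \<rho> k * denom d q y0 x \<and> denom d q y0 x \<le> \<rho> k * denom d q (Z k) x"
        if x: "x \<in> K" for x
      proof -
        have diff: "\<bar>denom d q (Z k) x - denom d q y0 x\<bar> \<le> e k"
          unfolding e_def by (rule denom_diff_le[OF x])
        have "e k = e k / \<eta> * \<eta>" using \<eta>(1) by simp
        also have "\<dots> \<le> e k / \<eta> * denom d q y0 x"
          using \<eta> x e_nonneg[of k] by (intro mult_left_mono) auto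
        also have "\<dots> \<le> 2 * e k / \<eta> * denom d q y0 x"
          using \<eta> x e_nonneg[of k] order_trans[OF less_imp_le[OF \<eta>(1)] \<eta>(2)[OF x]]
          by (intro mult_right_mono divide_right_mono) auto
        finally have 1: "denom d q (Z k) x \<le> \<rho> k * denom d q y0 x"
          using diff by (simp add: \<rho>_def distrib_right)
        have half: "denom d q (Z k) x \<ge> \<eta> / 2" using diff k \<eta>(2)[OF x] by linarith
        have "e k = 2 * e k / \<eta> * (\<eta> / 2)" using \<eta>(1) by simp
        also have "\<dots> \<le> 2 * e k / \<eta> * denom d q (Z k) x"
          using half \<eta>(1) e_nonneg[of k] by (intro mult_left_mono) auto
        finally have 2: "denom d q y0 x \<le> \<rho> k * denom d q (Z k) x"
          using diff by (simp add: \<rho>_def distrib_right)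
        show ?thesis using 1 2 by blast
      qed
      then have "?G y0 \<le> \<rho> k ^ (2 * n * (d + 1)) * ?G (Z k)"
        using True Z(1) \<rho>1 p by (intro objective_le_scaled) auto
      also have "\<dots> \<le> \<rho> k ^ (2 * n * (d + 1)) * (m + 1 / real (Suc k))"
        using Z(2)[of k] \<rho>1 by (intro mult_left_mono) auto
      finally show "?G y0 \<le> \<rho> k ^ (2 * n * (d + 1)) * (m + 1 / real (Suc k))" .
    qed
    have inv: "(\<lambda>k. 1 / real (Suc k)) \<longlonglongrightarrow> 0"
      using LIMSEQ_inverse_real_of_nat by (simp add: inverse_eq_divide)
    have "(\<lambda>k. \<rho> k ^ (2 * n * (d + 1)) * (m + 1 / real (Suc k))) \<longlonglongrightarrow> 1 ^ (2 * n * (d + 1)) * (m + 0)"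
      by (intro tendsto_intros \<rho> inv)
    then have "?G y0 \<le> 1 ^ (2 * n * (d + 1)) * (m + 0)"
      by (rule tendsto_lowerbound[OF _ ev]) simp
    then have "?G y0 \<le> m" by simp
    then show ?thesis using True m_le by (intro bexI[of _ y0] ballI) (auto intro: order_trans)
  next
    case False
    then obtain x where x: "x \<in> K" "denom d q y0 x = 0"
      using y0 by (force simp: polar_def polar_interior_def)
    define I where "I = {i \<in> {1..n}. denom d q y0 (p i) = 0}"
    define J where "J = {i \<in> {1..n}. denom d q y0 (p i) \<noteq> 0}"
    have IJ: "{1..n} = I \<union> J" "I \<inter> J = {}" "finite I" "finite J" by (auto simp: I_def J_def)
    have cardI: "(d + 1) * card I < n" unfolding I_def by (rule few[OF y0 x])
    have "\<forall>i\<in>I. \<exists>a>0. \<forall>y\<in>polar_interior. a / proj_volume y \<le> denom d q y (p i)"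
      using proj_volume_ge_at_hull_point[OF cf y0 p] by (auto simp: I_def)
    then obtain a where a: "\<And>i. i \<in> I \<Longrightarrow> a i > 0"
      "\<And>i y. i \<in> I \<Longrightarrow> y \<in> polar_interior \<Longrightarrow> a i / proj_volume y \<le> denom d q y (p i)"
      by metis
    obtain b where b: "b > 0" "\<And>y. y \<in> polar_interior \<Longrightarrow> b / proj_volume y \<le> denom d q y x"
      using proj_volume_ge_at_hull_point[OF cf y0 hull_inc[OF x(1)] x(2)] by blast
    define h where "h i = denom d q y0 (p i) / 2" for i
    have h: "h i > 0" if "i \<in> J" for i
      using that denom_nonneg_hull[of K d q y0 "p i"] p[of i] y0
      by (force simp: J_def h_def polar_def)
    define A where "A = (\<Prod>i\<in>I. a i ^ (d + 1)) * (\<Prod>i\<in>J. h i ^ (d + 1))"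
    have A: "A > 0" unfolding A_def using a(1) h by (intro mult_pos_pos prod_pos) auto
    have "eventually (\<lambda>k. denom d q (Z k) (p i) \<ge> h i) sequentially" if "i \<in> J" for i
      using order_tendstoD(1)[OF denom_lim, of "h i" "p i"] h[OF that]
      by (auto simp: h_def elim: eventually_mono)
    then have evJ: "eventually (\<lambda>k. \<forall>i\<in>J. denom d q (Z k) (p i) \<ge> h i) sequentially"
      using IJ(4) by (simp add: eventually_ball_finite)
    \<comment> \<open>Requiring the denominator to be below \<open>b\<close> forces the volume to be at least \<open>1\<close>, so that its powers
      can be compared.\<close>
    have "eventually (\<lambda>k. denom d q (Z k) x < b) sequentially"
      using order_tendstoD(2)[OF denom_lim, of x b] x(2) b(1) by simp
    then have "eventually (\<lambda>k. A * b / (m + 1) \<le> denom d q (Z k) x) sequentially"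
      using evJ
    proof eventually_elim
      case (elim k)
      define w where "w = proj_volume (Z k)"
      have w: "w > 0" unfolding w_def by (rule proj_volume_pos[OF Z(1)])
      have dx: "denom d q (Z k) x > 0" using Z(1)[of k] x(1) by (auto simp: polar_interior_def)
      have bw: "b / w \<le> denom d q (Z k) x" unfolding w_def by (rule b(2)[OF Z(1)])
      then have "b / w < b" using elim(1) by linarith
      then have w1: "w \<ge> 1" using b(1) w by (simp add: field_simps)
      define D where "D i = denom d q (Z k) (p i)" for i
      have D_I: "a i / w \<le> D i" if "i \<in> I" for i
        unfolding w_def D_def using a(2)[OF that Z(1)] .
      have "(\<Prod>i\<in>I. (a i / w) ^ (d + 1)) \<le> (\<Prod>i\<in>I. D i ^ (d + 1))"
        using a(1) w D_I by (intro prod_mono conjI power_mono zero_le_power) (auto intro: less_imp_le)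
      moreover have "(\<Prod>i\<in>J. h i ^ (d + 1)) \<le> (\<Prod>i\<in>J. D i ^ (d + 1))"
        using h elim(2) by (intro prod_mono conjI power_mono zero_le_power) (auto simp: D_def intro: less_imp_le)
      ultimately have "w ^ n * ((\<Prod>i\<in>I. (a i / w) ^ (d + 1)) * (\<Prod>i\<in>J. h i ^ (d + 1)))
          \<le> w ^ n * ((\<Prod>i\<in>I. D i ^ (d + 1)) * (\<Prod>i\<in>J. D i ^ (d + 1)))"
        using w a(1) h D_I
        by (intro mult_left_mono mult_mono prod_nonneg zero_le_power order_trans[OF _ D_I])
          (auto intro: less_imp_le)
      also have "\<dots> = ?G (Z k)"
        unfolding objective_def IJ(1) prod.union_disjoint[OF IJ(3,4,2)] D_def w_def ..
      also have "\<dots> \<le> m + 1"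
      proof -
        have "1 / real (Suc k) \<le> 1" by simp
        then show ?thesis using Z(2)[of k] by linarith
      qed
      finally have "w ^ n * ((\<Prod>i\<in>I. (a i / w) ^ (d + 1)) * (\<Prod>i\<in>J. h i ^ (d + 1))) \<le> m + 1" .
      moreover have "(\<Prod>i\<in>I. (a i / w) ^ (d + 1)) = (\<Prod>i\<in>I. a i ^ (d + 1)) / w ^ ((d + 1) * card I)"
        by (simp only: power_divide prod_dividef prod_constant power_mult)
      ultimately have "A * (w ^ n / w ^ ((d + 1) * card I)) \<le> m + 1"
        by (simp add: A_def field_simps del: power_Suc)
      moreover have "w ^ n / w ^ ((d + 1) * card I) = w ^ (n - (d + 1) * card I)"
        using cardI w by (intro power_diff[symmetric]) auto
      moreover have "w ^ 1 \<le> w ^ (n - (d + 1) * card I)"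
        using cardI w1 by (intro power_increasing) auto
      ultimately have "A * w \<le> m + 1"
        using A by (metis (no_types) less_imp_le mult_left_mono order_trans power_one_right)
      then have "A * w * b \<le> (m + 1) * b" and "m + 1 > 0"
        using b(1) mult_pos_pos[OF A w] by (auto intro: mult_right_mono)
      then have "A * b / (m + 1) \<le> b / w"
        using w by (simp add: pos_divide_le_eq pos_le_divide_eq mult_ac)
      then show ?case using bw by linarith
    qed
    then have "A * b / (m + 1) \<le> denom d q y0 x"
      using denom_lim[of x] by (intro tendsto_lowerbound) auto
    moreover have "m \<ge> 0"
      unfolding m_def using zero_in objective_pos[OF _ p] by (intro cINF_greatest) (auto intro: less_imp_le)
    ultimately show ?thesis
      using A b(1) x(2) by (simp add: field_simps mult_pos_pos not_less[symmetric])
  qed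
qed

end

section \<open>A minimiser balances centroid and mean\<close>

lemma nn_integral_set_eq_set_integral:
  fixes f :: "point \<Rightarrow> real"
  assumes A: "A \<in> sets borel" "emeasure (lborel_space d) A < \<infinity>"
    and [measurable]: "f \<in> borel_measurable borel" and f: "\<And>x. x \<in> A \<Longrightarrow> 0 \<le> f x" "\<And>x. x \<in> A \<Longrightarrow> f x \<le> B"
  shows "(\<integral>\<^sup>+x\<in>A. ennreal (f x) \<partial>lborel_space d) = ennreal (LINT x:A|lborel_space d. f x)"
proof -
  have "integrable (lborel_space d) (\<lambda>x. indicator A x *\<^sub>R f x)"
    using A f by (intro integrableI_bounded_set_indicator[of _ _ _ B]) auto
  moreover have "(\<integral>\<^sup>+x\<in>A. ennreal (f x) \<partial>lborel_space d) =
      (\<integral>\<^sup>+x. ennreal (indicator A x *\<^sub>R f x) \<partial>lborel_space d)"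
    by (intro nn_integral_cong) (auto simp: indicator_def)
  ultimately show ?thesis
    unfolding set_lebesgue_integral_def using f(1)
    by (subst nn_integral_eq_integral[symmetric]) (auto simp: indicator_def)
qed

text \<open>
  A change of \<open>y\<close> acts on the projective image as one more projective map, with the functional
  \<open>1 - t z\<^sub>j\<close>. So all derivatives can be taken at the identity, in the coordinates of the image.
\<close>

lemma denom_shift:
  assumes "j < d" "denom d q y x \<noteq> 0"
  shows "denom d q (y(j := y j + t)) x = denom d q y x * (1 - t * proj_map d q y x j)"
proof -
  have "(\<Sum>i<d. (y(j := y j + t)) i * (x i - q i)) =
      (\<Sum>i<d. y i * (x i - q i) + (if i = j then t * (x j - q j) else 0))"
    by (intro sum.cong) (auto simp: algebra_simps)
  then have "denom d q (y(j := y j + t)) x = denom d q y x - t * (x j - q j)"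
    using assms(1) by (simp add: denom_def sum.distrib)
  moreover have "D * (1 - t * (c / D)) = D - t * c" if "D \<noteq> 0" for D c :: real
    using that by (simp add: field_simps)
  ultimately show ?thesis using assms(2) by (simp add: proj_map_def)
qed

context pointed_body
begin

lemma proj_map_bounded:
  assumes "y \<in> polar_interior"
  shows "\<exists>R>0. \<forall>x\<in>K. \<forall>j<d. \<bar>proj_map d q y x j\<bar> \<le> R"
proof -
  obtain \<eta> where \<eta>: "\<eta> > 0" "\<And>x. x \<in> K \<Longrightarrow> denom d q y x \<ge> \<eta>"
    using denom_lower_bound[OF assms] by blast
  have "\<bar>proj_map d q y x j\<bar> \<le> radius / \<eta>" if "x \<in> K" "j < d" for x j
  proof -
    have "\<bar>proj_map d q y x j\<bar> = \<bar>x j - q j\<bar> / denom d q y x"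
      using \<eta>(1) \<eta>(2)[OF that(1)] by (simp add: proj_map_def)
    also have "\<dots> \<le> radius / \<eta>"
      using \<eta> that radius_bound radius_pos by (intro frac_le) auto
    finally show ?thesis .
  qed
  then show ?thesis using \<eta>(1) radius_pos by (intro exI[of _ "radius / \<eta>"]) auto
qed

lemma proj_map_image_borel:
  assumes "y \<in> polar_interior"
  shows "proj_map d q y ` K \<in> sets borel"
  using assms by (intro borel_closed compact_imp_closed compact_continuous_image compact_K continuous_on_proj_map)
    (auto simp: polar_interior_def)

lemma emeasure_proj_map_image:
  assumes "y \<in> polar_interior"
  shows "emeasure (lborel_space d) (proj_map d q y ` K) = ennreal (proj_volume y)"
proof -
  have "emeasure (lborel_space d) (proj_map d q y ` K) = (\<integral>\<^sup>+z\<in>proj_map d q y ` K. 1 \<partial>lborel_space d)"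
    using proj_map_image_borel[OF assms] by simp
  also have "\<dots> = (\<integral>\<^sup>+x\<in>K. 1 * ennreal (inverse (denom d q y x ^ (d + 1))) \<partial>lborel_space d)"
    using assms q_in by (intro nn_integral_proj_map_image) (auto simp: polar_interior_def)
  also have "\<dots> = ennreal (proj_volume y)"
    using proj_volume_finite[OF assms] by simp
  finally show ?thesis .
qed

lemma proj_volume_shift:
  assumes y: "y \<in> polar_interior" "y(j := y j + t) \<in> polar_interior" and j: "j < d"
  shows "ennreal (proj_volume (y(j := y j + t))) =
    (\<integral>\<^sup>+z\<in>proj_map d q y ` K. ennreal (inverse ((1 - t * z j) ^ (d + 1))) \<partial>lborel_space d)"
proof -
  have pos: "denom d q y x > 0" if "x \<in> K" for x
    using y(1) that by (auto simp: polar_interior_def)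
  have "ennreal (proj_volume (y(j := y j + t))) =
      (\<integral>\<^sup>+x\<in>K. ennreal (inverse (denom d q (y(j := y j + t)) x ^ (d + 1))) \<partial>lborel_space d)"
    by (simp only: proj_volume_finite[OF y(2)])
  also have "\<dots> = (\<integral>\<^sup>+x\<in>K. ennreal (inverse ((1 - t * proj_map d q y x j) ^ (d + 1))) *
      ennreal (inverse (denom d q y x ^ (d + 1))) \<partial>lborel_space d)"
  proof (rule nn_integral_cong)
    fix x
    show "ennreal (inverse (denom d q (y(j := y j + t)) x ^ (d + 1))) * indicator K x =
      ennreal (inverse ((1 - t * proj_map d q y x j) ^ (d + 1))) *
      ennreal (inverse (denom d q y x ^ (d + 1))) * indicator K x"
    proof (cases "x \<in> K")
      case True
      have eq: "denom d q (y(j := y j + t)) x = denom d q y x * (1 - t * proj_map d q y x j)"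
        using pos[OF True] by (intro denom_shift j) simp
      have "inverse (denom d q (y(j := y j + t)) x ^ (d + 1)) =
          inverse ((1 - t * proj_map d q y x j) ^ (d + 1)) * inverse (denom d q y x ^ (d + 1))"
        unfolding eq power_mult_distrib by (simp add: mult.commute)
      then show ?thesis
        using pos[OF True] True by (simp add: ennreal_mult'' del: power_Suc)
    qed simp
  qed
  also have "\<dots> = (\<integral>\<^sup>+z\<in>proj_map d q y ` K. ennreal (inverse ((1 - t * z j) ^ (d + 1))) \<partial>lborel_space d)"
    using pos q_in by (intro nn_integral_proj_map_image[symmetric]) auto
  finally show ?thesis .
qed

lemma proj_map_shift_in_interior:
  assumes y: "y \<in> polar_interior" and j: "j < d" and small: "\<And>x. x \<in> K \<Longrightarrow> \<bar>t * proj_map d q y x j\<bar> \<le> 1 / 2"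
  shows "y(j := y j + t) \<in> polar_interior"
proof -
  have "denom d q (y(j := y j + t)) x > 0" if x: "x \<in> K" for x
  proof -
    have pos: "denom d q y x > 0" using y x by (auto simp: polar_interior_def)
    have "1 - t * proj_map d q y x j > 0" using small[OF x] by (auto simp: abs_le_iff)
    then show ?thesis using denom_shift[of j d q y x t] j pos by simp
  qed
  then show ?thesis using y j by (auto simp: polar_interior_def R_space_iff)
qed

text \<open>
  Integrate the quadratic estimate for \<open>(1 - t z\<^sub>j)^(-(d + 1))\<close> over the projective image \<open>\<phi>\<^sub>y K\<close>; the
  linear term integrates to the centroid.
\<close>

lemma proj_volume_shift_le:
  assumes y: "y \<in> polar_interior" and j: "j < d"
  shows "\<exists>\<epsilon>>0. \<exists>C. \<forall>t. \<bar>t\<bar> < \<epsilon> \<longrightarrow> y(j := y j + t) \<in> polar_interior \<and>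
    proj_volume (y(j := y j + t)) / proj_volume y
      \<le> 1 + real (d + 1) * t * centroid d (proj_map d q y ` K) j + C * t\<^sup>2"
proof -
  let ?K = "proj_map d q y ` K" and ?M = "lborel_space d"
  define V where "V = proj_volume y"
  have V: "V > 0" unfolding V_def by (rule proj_volume_pos[OF y])
  obtain R where R: "R > 0" "\<And>x. x \<in> K \<Longrightarrow> \<bar>proj_map d q y x j\<bar> \<le> R"
    using proj_map_bounded[OF y] j by blast
  have K' [measurable]: "?K \<in> sets borel" by (rule proj_map_image_borel[OF y])
  have eK: "emeasure ?M ?K = ennreal V" unfolding V_def by (rule emeasure_proj_map_image[OF y])
  have mK: "measure ?M ?K = V" using eK V by (simp add: measure_def)
  obtain C where C: "C \<ge> 0"
    "\<And>s::real. \<bar>s\<bar> \<le> 1/2 \<Longrightarrow> inverse ((1 - s) ^ (d + 1)) \<le> 1 + real (d + 1) * s + C * s\<^sup>2"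
    using inverse_power_le_quadratic[of "d + 1"] by blast
  \<comment> \<open>This keeps \<open>\<bar>t * z j\<bar> \<le> 1 / 2\<close> on the projective image, the range of the quadratic estimate.\<close>
  define \<epsilon> where "\<epsilon> = 1 / (2 * R)"
  have \<epsilon>: "\<epsilon> > 0" using R by (simp add: \<epsilon>_def)
  define Z where "Z = (LINT z:?K|?M. z j)"
  have g: "centroid d ?K j = Z / V"
    by (simp add: centroid_def mK Z_def)
  have int_bounded: "set_integrable ?M ?K f"
    if [measurable]: "f \<in> borel_measurable borel" and "\<And>z. z \<in> ?K \<Longrightarrow> \<bar>f z\<bar> \<le> B" for f :: "point \<Rightarrow> real" and B
    unfolding set_integrable_def
    using that eK by (intro integrableI_bounded_set_indicator[of _ _ _ B]) auto
  have "y(j := y j + t) \<in> polar_interior \<and>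
    proj_volume (y(j := y j + t)) / V \<le> 1 + real (d + 1) * t * (Z / V) + (C * R\<^sup>2) * t\<^sup>2"
    if t: "\<bar>t\<bar> < \<epsilon>" for t
  proof
    have tR: "\<bar>t\<bar> * R \<le> 1 / 2" using t R(1) by (simp add: \<epsilon>_def field_simps)
    have small: "\<bar>t * proj_map d q y x j\<bar> \<le> 1 / 2" if "x \<in> K" for x
      using mult_left_mono[OF R(2)[OF that], of "\<bar>t\<bar>"] tR by (simp add: abs_mult)
    show yt: "y(j := y j + t) \<in> polar_interior"
      by (rule proj_map_shift_in_interior[OF y j small])
    define f where "f z = 1 + real (d + 1) * (t * z j) + C * R\<^sup>2 * t\<^sup>2" for z :: point
    have f_meas [measurable]: "f \<in> borel_measurable borel" unfolding f_def by measurable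
    have le_f: "inverse ((1 - t * z j) ^ (d + 1)) \<le> f z" if z: "z \<in> ?K" for z
    proof -
      have s: "\<bar>t * z j\<bar> \<le> 1 / 2" using z small by auto
      have "\<bar>z j\<bar> \<le> R" using z R(2) by auto
      then have "(z j)\<^sup>2 \<le> R\<^sup>2" by (simp add: abs_le_square_iff[symmetric] R(1) less_imp_le)
      then have "C * (t * z j)\<^sup>2 \<le> C * R\<^sup>2 * t\<^sup>2"
        using C(1) mult_left_mono[of "(z j)\<^sup>2" "R\<^sup>2" "C * t\<^sup>2"] by (simp add: power_mult_distrib mult_ac)
      then show ?thesis using C(2)[OF s] by (simp add: f_def)
    qed
    have f_nonneg: "0 \<le> f z" if z: "z \<in> ?K" for z
    proof -
      have "\<bar>t * z j\<bar> \<le> 1 / 2" using z small by auto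
      then have "0 \<le> inverse ((1 - t * z j) ^ (d + 1))" by (auto simp: abs_le_iff)
      then show ?thesis using le_f[OF z] by linarith
    qed
    have f_le: "f z \<le> 1 + real (d + 1) * (1 / 2) + C * R\<^sup>2 * t\<^sup>2" if z: "z \<in> ?K" for z
    proof -
      have "\<bar>t * z j\<bar> \<le> 1 / 2" using z small by auto
      then have "t * z j \<le> 1 / 2" by (rule order_trans[OF abs_ge_self])
      then have "real (d + 1) * (t * z j) \<le> real (d + 1) * (1 / 2)" by (intro mult_left_mono) auto
      then show ?thesis by (simp add: f_def)
    qed
    have "ennreal (proj_volume (y(j := y j + t))) =
        (\<integral>\<^sup>+z\<in>?K. ennreal (inverse ((1 - t * z j) ^ (d + 1))) \<partial>?M)"
      by (rule proj_volume_shift[OF y yt j])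
    also have "\<dots> \<le> (\<integral>\<^sup>+z\<in>?K. ennreal (f z) \<partial>?M)"
    proof (intro nn_integral_mono)
      fix z
      show "ennreal (inverse ((1 - t * z j) ^ (d + 1))) * indicator ?K z \<le> ennreal (f z) * indicator ?K z"
        using le_f[of z] by (cases "z \<in> ?K") (auto simp del: power_Suc intro: ennreal_leI)
    qed
    also have "\<dots> = ennreal (LINT z:?K|?M. f z)"
      using eK by (intro nn_integral_set_eq_set_integral[OF K' _ f_meas f_nonneg f_le]) auto
    also have "(LINT z:?K|?M. f z) = (LINT z:?K|?M. (1 + C * R\<^sup>2 * t\<^sup>2) + (real (d + 1) * t) * z j)"
      by (simp add: f_def algebra_simps)
    also have "\<dots> = (LINT z:?K|?M. 1 + C * R\<^sup>2 * t\<^sup>2) + (LINT z:?K|?M. (real (d + 1) * t) * z j)"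
    proof (rule set_integral_add)
      show "set_integrable ?M ?K (\<lambda>z. 1 + C * R\<^sup>2 * t\<^sup>2)" by (rule int_bounded) auto
      show "set_integrable ?M ?K (\<lambda>z. (real (d + 1) * t) * z j)"
        using R(2) by (intro set_integrable_mult_right int_bounded[of _ R]) auto
    qed
    also have "\<dots> = V * (1 + C * R\<^sup>2 * t\<^sup>2) + (real (d + 1) * t) * Z"
      using eK by (simp add: set_integral_mult_right Z_def set_integral_const mK mult.commute)
    finally have le: "ennreal (proj_volume (y(j := y j + t))) \<le> ennreal (V * (1 + C * R\<^sup>2 * t\<^sup>2) + (real (d + 1) * t) * Z)" .
    have "proj_volume (y(j := y j + t)) \<le> V * (1 + C * R\<^sup>2 * t\<^sup>2) + (real (d + 1) * t) * Z"
      using le proj_volume_pos[OF yt] by (simp add: ennreal_le_iff2)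
    then show "proj_volume (y(j := y j + t)) / V \<le> 1 + real (d + 1) * t * (Z / V) + (C * R\<^sup>2) * t\<^sup>2"
      using V by (simp add: pos_divide_le_eq algebra_simps)
  qed
  then show ?thesis using \<epsilon> unfolding g V_def by blast
qed

text \<open>
  Moving \<open>y\<close> in direction \<open>j\<close> multiplies each denominator at \<open>p\<^sub>i\<close> by \<open>1 - t z\<^sub>i\<^sub>j\<close>, where \<open>z\<^sub>i\<close> is the image of
  \<open>p\<^sub>i\<close>, and the volume by at most \<open>1 + (d + 1) t g\<^sub>j\<close> up to a quadratic error, where \<open>g\<close> is the
  centroid. Minimality for both signs of \<open>t\<close> leaves only equality of \<open>g\<^sub>j\<close> and the mean of the \<open>z\<^sub>i\<^sub>j\<close>.
\<close>

lemma centroid_at_minimizer: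
  assumes y: "y \<in> polar_interior" and min: "\<And>y'. y' \<in> polar_interior \<Longrightarrow> objective n p y \<le> objective n p y'"
    and p: "\<And>i. i \<in> {1..n} \<Longrightarrow> p i \<in> convex hull K" and n: "n \<ge> 1"
  shows "centroid d (proj_map d q y ` K) = (1 / real n) *\<^sub>R (\<Sum>i=1..n. proj_map d q y (p i))"
proof
  fix j
  let ?K = "proj_map d q y ` K"
  have pR: "p i \<in> R_space d" if "i \<in> {1..n}" for i
    using p[OF that] hull_subset_R_space[OF K_sub] by blast
  show "centroid d ?K j = ((1 / real n) *\<^sub>R (\<Sum>i=1..n. proj_map d q y (p i))) j"
  proof (cases "j < d")
    case False
    have "z j = 0" if "z \<in> ?K" for z
    proof -
      have "z \<in> R_space d" using that K_sub q_in by (auto intro: proj_map_in_R_space)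
      then show ?thesis using False by (simp add: R_space_iff)
    qed
    then have "indicator ?K z *\<^sub>R z j = (0::real)" for z
      by (cases "z \<in> ?K") auto
    then have "centroid d ?K j = 0"
      by (simp only: centroid_def set_lebesgue_integral_def) simp
    moreover have "(\<Sum>i=1..n. proj_map d q y (p i) j) = 0"
      using proj_map_in_R_space[OF pR q_in] False by (intro sum.neutral) (auto simp: R_space_iff)
    ultimately show ?thesis by (simp add: scaleR_fun_def sum_point_apply)
  next
    case True
    obtain \<epsilon> C where \<epsilon>: "\<epsilon> > 0" and shift: "\<And>t. \<bar>t\<bar> < \<epsilon> \<Longrightarrow> y(j := y j + t) \<in> polar_interior"
      "\<And>t. \<bar>t\<bar> < \<epsilon> \<Longrightarrow> proj_volume (y(j := y j + t)) / proj_volume y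
        \<le> 1 + real (d + 1) * t * centroid d ?K j + C * t\<^sup>2"
      using proj_volume_shift_le[OF y True] by blast
    have Vpos: "proj_volume y > 0" by (rule proj_volume_pos[OF y])
    have dp: "denom d q y (p i) > 0" if "i \<in> {1..n}" for i
      by (rule denom_hull_pos[OF y p[OF that]])
    have dt: "denom d q (y(j := y j + t)) (p i) = denom d q y (p i) * (1 - t * proj_map d q y (p i) j)"
      if "i \<in> {1..n}" for i t
      using dp[OF that] by (intro denom_shift True) simp
    have "real n * centroid d ?K j = (\<Sum>i=1..n. proj_map d q y (p i) j)"
    proof (rule mean_eq_of_product_ge_1[where N = "d + 1" and C = C and \<epsilon> = \<epsilon> and
          f = "\<lambda>t. proj_volume (y(j := y j + t)) / proj_volume y"])
      show "0 \<le> proj_volume (y(j := y j + t)) / proj_volume y \<and>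
          proj_volume (y(j := y j + t)) / proj_volume y
          \<le> 1 + real (d + 1) * t * centroid d ?K j + C * t\<^sup>2" if "\<bar>t\<bar> < \<epsilon>" for t
        using shift[OF that] Vpos proj_volume_pos by (auto intro: less_imp_le)
      show "0 \<le> 1 - t * proj_map d q y (p i) j" if "\<bar>t\<bar> < \<epsilon>" "i \<in> {1..n}" for t i
        using denom_hull_pos[OF shift(1)[OF that(1)] p[OF that(2)]] dp[OF that(2)] dt[OF that(2)]
        by (simp add: zero_less_mult_iff)
      show "1 \<le> (proj_volume (y(j := y j + t)) / proj_volume y) ^ n *
          (\<Prod>i=1..n. (1 - t * proj_map d q y (p i) j) ^ (d + 1))" if "\<bar>t\<bar> < \<epsilon>" for t
      proof -
        have "objective n p (y(j := y j + t)) = proj_volume (y(j := y j + t)) ^ n *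
            (\<Prod>i=1..n. (1 - t * proj_map d q y (p i) j) ^ (d + 1)) * (\<Prod>i=1..n. denom d q y (p i) ^ (d + 1))"
          unfolding objective_def mult.assoc prod.distrib[symmetric]
          by (intro arg_cong2[of _ _ _ _ "(*)"] prod.cong refl)
            (simp add: dt power_mult_distrib mult.commute del: power_Suc)
        moreover have "(\<Prod>i=1..n. denom d q y (p i) ^ (d + 1)) > 0"
          using dp by (intro prod_pos) auto
        ultimately have "proj_volume y ^ n \<le> proj_volume (y(j := y j + t)) ^ n *
            (\<Prod>i=1..n. (1 - t * proj_map d q y (p i) j) ^ (d + 1))"
          using min[OF shift(1)[OF that]] by (simp only: objective_def mult_le_cancel_right_pos)
        then show ?thesis using Vpos by (simp add: power_divide)
      qed
    qed (use \<epsilon> in auto)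
    then show ?thesis using n by (simp add: scaleR_fun_def sum_point_apply field_simps)
  qed
qed

end

section \<open>Projective transformations\<close>

text \<open>
  The linear map of \<open>\<real>\<^sup>d\<^sup>+\<^sup>1\<close> that induces \<open>proj_map d q y\<close> on the affine chart.
\<close>

definition proj_lin :: "nat \<Rightarrow> point \<Rightarrow> point \<Rightarrow> point \<Rightarrow> point"
  where "proj_lin d q y v =
    case_nat (v 0 - (\<Sum>k<d. y k * (v (Suc k) - v 0 * q k))) (\<lambda>k. v (Suc k) - v 0 * q k)"

definition proj_trans :: "nat \<Rightarrow> point \<Rightarrow> point \<Rightarrow> point set \<Rightarrow> point set"
  where "proj_trans d q y l = proj_lin d q y ` l"

lemma linear_proj_lin: "linear (proj_lin d q y)"
proof (rule linearI)
  fix v w :: point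
  show "proj_lin d q y (v + w) = proj_lin d q y v + proj_lin d q y w"
    by (auto simp: proj_lin_def plus_fun_def fun_eq_iff algebra_simps sum.distrib sum_subtractf split: nat.split)
next
  fix c :: real and v :: point
  show "proj_lin d q y (c *\<^sub>R v) = c *\<^sub>R proj_lin d q y v"
    by (auto simp: proj_lin_def scaleR_fun_def fun_eq_iff algebra_simps sum_subtractf sum_distrib_left split: nat.split)
qed

lemma bij_betw_proj_lin:
  assumes q: "q \<in> R_space d"
  shows "bij_betw (proj_lin d q y) (R_space (d + 1)) (R_space (d + 1))"
proof (rule bij_betw_byWitness)
  let ?v0 = "\<lambda>w. w 0 + (\<Sum>k<d. y k * w (Suc k))"
  let ?inv = "\<lambda>w::point. case_nat (?v0 w) (\<lambda>k. w (Suc k) + ?v0 w * q k)"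
  show "\<forall>v\<in>R_space (d + 1). ?inv (proj_lin d q y v) = v"
    by (auto simp: proj_lin_def fun_eq_iff split: nat.split)
  show "\<forall>w\<in>R_space (d + 1). proj_lin d q y (?inv w) = w"
    by (auto simp: proj_lin_def fun_eq_iff split: nat.split)
  have mem: "u \<in> R_space (Suc d) \<longleftrightarrow> (\<forall>k\<ge>d. u (Suc k) = 0)" for u
    unfolding R_space_iff by (metis Suc_le_D Suc_le_mono)
  show "proj_lin d q y ` R_space (d + 1) \<subseteq> R_space (d + 1)"
    using q by (auto simp: mem proj_lin_def R_space_iff[of q])
  show "?inv ` R_space (d + 1) \<subseteq> R_space (d + 1)"
    using q by (auto simp: mem R_space_iff[of q])
qed

lemma projective_transformation_proj_trans:
  "q \<in> R_space d \<Longrightarrow> projective_transformation d (proj_trans d q y)"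
  unfolding projective_transformation_def
  by (intro exI[of _ "proj_lin d q y"] conjI linear_proj_lin bij_betw_proj_lin) (simp_all add: proj_trans_def)

lemma chart_eq: "chart x = range (\<lambda>k. k *\<^sub>R (case_nat 1 x :: point))"
  by (simp add: chart_def span_singleton)

lemma chart_inject: "chart x = chart y \<longleftrightarrow> x = y"
proof
  assume "chart x = chart y"
  moreover have "case_nat 1 x \<in> chart x" unfolding chart_def by (rule span_base) simp
  ultimately obtain k where k: "case_nat 1 x = k *\<^sub>R (case_nat 1 y :: point)" by (auto simp: chart_eq)
  then have "(case_nat 1 x :: point) i = k * case_nat 1 y i" for i
    by (simp add: scaleR_fun_def)
  from this[of 0] this[of "Suc _"] show "x = y" by auto
qed simp

lemma proj_lin_chart: "proj_lin d q y (case_nat 1 x) = case_nat (denom d q y x) (\<lambda>k. x k - q k)"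
  by (auto simp: proj_lin_def denom_def)

lemma proj_trans_chart:
  assumes "denom d q y x \<noteq> 0"
  shows "proj_trans d q y (chart x) = chart (proj_map d q y x)"
proof -
  have "proj_lin d q y (case_nat 1 x) = denom d q y x *\<^sub>R case_nat 1 (proj_map d q y x)"
    unfolding proj_lin_chart using assms
    by (auto simp: fun_eq_iff scaleR_fun_def proj_map_def split: nat.split)
  then have "proj_trans d q y (chart x) =
      range (\<lambda>k. (k * denom d q y x) *\<^sub>R (case_nat 1 (proj_map d q y x) :: point))"
    by (simp add: proj_trans_def chart_eq image_image linear_scale[OF linear_proj_lin])
  also have "\<dots> = range (\<lambda>k. k *\<^sub>R (case_nat 1 (proj_map d q y x) :: point))"
  proof -
    have "range (\<lambda>k. k * denom d q y x) = UNIV"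
      using assms by (intro surjI[of _ "\<lambda>k. k / denom d q y x"]) simp
    then show ?thesis
      using image_image[of "\<lambda>k. k *\<^sub>R (case_nat 1 (proj_map d q y x) :: point)" "\<lambda>k. k * denom d q y x" UNIV]
      by simp
  qed
  finally show ?thesis by (simp add: chart_eq)
qed

lemma act_eqI: "z \<in> R_space d \<Longrightarrow> \<phi> (chart x) = chart z \<Longrightarrow> act d \<phi> x = z"
  unfolding act_def by (rule the_equality) (auto simp: chart_inject)

lemma act_proj_trans:
  assumes "x \<in> R_space d" "q \<in> R_space d" "denom d q y x \<noteq> 0"
  shows "act d (proj_trans d q y) x = proj_map d q y x"
  using assms by (intro act_eqI proj_map_in_R_space proj_trans_chart)

lemma admissible_proj_trans:
  assumes "K \<subseteq> R_space d" "q \<in> R_space d" "\<And>x. x \<in> convex hull K \<Longrightarrow> denom d q y x \<noteq> 0"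
  shows "admissible d (proj_trans d q y) K"
  unfolding admissible_def
proof (intro subsetI)
  fix l assume "l \<in> proj_trans d q y ` chart ` (convex hull K)"
  then obtain x where x: "x \<in> convex hull K" "l = proj_trans d q y (chart x)" by blast
  have "x \<in> R_space d" using x(1) hull_subset_R_space[OF assms(1)] by blast
  then show "l \<in> chart ` R_space d"
    using x proj_trans_chart[OF assms(3)[OF x(1)]] proj_map_in_R_space[OF _ assms(2)] by auto
qed

lemma support_hyperplane_denom_zero:
  assumes K: "K \<subseteq> R_space d" and nonneg: "\<And>x. x \<in> K \<Longrightarrow> denom d q y x \<ge> 0"
    and x: "x \<in> K" "denom d q y x = 0"
  shows "support_hyperplane d K {x \<in> R_space d. denom d q y x = 0}"
proof -
  have den: "denom d q y u = 1 + (\<Sum>i<d. y i * q i) - (\<Sum>i<d. y i * u i)" for u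
    by (simp add: denom_def right_diff_distrib sum_subtractf)
  have "\<exists>i<d. y i \<noteq> 0"
  proof (rule ccontr)
    assume "\<not> (\<exists>i<d. y i \<noteq> 0)"
    then have "denom d q y x = 1" by (simp add: denom_def)
    then show False using x(2) by simp
  qed
  moreover have "{x \<in> R_space d. denom d q y x = 0} =
      {x \<in> R_space d. (\<Sum>i<d. y i * x i) = 1 + (\<Sum>i<d. y i * q i)}"
    by (auto simp: den)
  moreover have "K \<subseteq> {x \<in> R_space d. (\<Sum>i<d. y i * x i) \<le> 1 + (\<Sum>i<d. y i * q i)}"
    using K nonneg by (fastforce simp: den)
  ultimately show ?thesis
    unfolding support_hyperplane_def using x K by blast
qed

text \<open>
  Applied to the counting hypothesis, this excludes \<open>n = 0\<close>.
\<close>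

lemma exists_support_hyperplane:
  assumes "1 \<le> d" "compact K" "K \<subseteq> R_space d" "K \<noteq> {}"
  shows "\<exists>H. support_hyperplane d K H"
proof -
  have "continuous_on K (\<lambda>x. x 0)"
    by (rule continuous_on_subset[OF continuous_on_product_coordinates]) simp
  then obtain z where z: "z \<in> K" "\<And>x. x \<in> K \<Longrightarrow> x 0 \<le> z 0"
    using continuous_attains_sup[OF assms(2,4)] by blast
  have sum: "(\<Sum>i<d. unit_point 0 i * x i) = x 0" for x
    using assms(1) by (simp add: unit_point_def if_distrib[of "\<lambda>u. u * _"] cong: if_cong)
  have "support_hyperplane d K {x \<in> R_space d. (\<Sum>i<d. unit_point 0 i * x i) = z 0}"
    unfolding support_hyperplane_def
  proof (intro conjI exI[of _ "unit_point 0"] exI[of _ "z 0"])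
    show "\<exists>i<d. unit_point 0 i \<noteq> 0" using assms(1) by (intro exI[of _ 0]) (simp add: unit_point_def)
    show "{x \<in> R_space d. (\<Sum>i<d. unit_point 0 i * x i) = z 0} \<inter> K \<noteq> {}"
      unfolding sum using z(1) assms(3) by blast
    show "K \<subseteq> {x \<in> R_space d. (\<Sum>i<d. unit_point 0 i * x i) \<le> z 0} \<or>
      K \<subseteq> {x \<in> R_space d. z 0 \<le> (\<Sum>i<d. unit_point 0 i * x i)}"
      unfolding sum using z(2) assms(3) by blast
  qed simp
  then show ?thesis by blast
qed

theorem exists_projective_centering:
  fixes d n :: nat and K :: "point set" and p :: "nat \<Rightarrow> point"
  assumes d: "1 \<le> d" and comp: "compactin (Euclidean_space d) K" and full: "full_dimensional d K"
    and cf: "cusp_free d K"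
    and reg: "K = Euclidean_space d closure_of (Euclidean_space d interior_of K)"
    and p: "\<forall>i\<in>{1..n}. p i \<in> convex hull K"
    and few: "\<forall>H. support_hyperplane d K H \<longrightarrow>
      real (card {i\<in>{1..n}. p i \<in> H}) < real n / real (d + 1)"
  shows "\<exists>\<phi>. projective_transformation d \<phi> \<and> admissible d \<phi> K \<and>
    centroid d (act d \<phi> ` K) = (1 / real n) *\<^sub>R (\<Sum>i=1..n. act d \<phi> (p i))"
proof -
  have cK: "compact K" and KR: "K \<subseteq> R_space d"
    using comp by (auto simp: Euclidean_space_def compactin_subtopology euclidean_product_topology)
  have "K \<noteq> {}"
  proof
    assume "K = {}"
    then have "R_space d = {}" using full by (simp add: full_dimensional_def)
    moreover have "(\<lambda>_. 0) \<in> R_space d" by (simp add: R_space_iff)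
    ultimately show False by simp
  qed
  then have "Euclidean_space d interior_of K \<noteq> {}" using reg by (metis closure_of_empty)
  then obtain U q where U: "openin (Euclidean_space d) U" "q \<in> U" "U \<subseteq> K"
    by (auto simp: interior_of_def)
  obtain r where r: "r > 0" "cube d q r \<subseteq> U"
    using openin_Euclidean_space_cube[OF U(1,2)] by blast
  interpret pointed_body d K q r
    using cK KR U r by unfold_locales auto
  have n: "n \<ge> 1"
    using exists_support_hyperplane[OF d cK KR \<open>K \<noteq> {}\<close>] few by (cases n) fastforce+
  have p': "\<And>i. i \<in> {1..n} \<Longrightarrow> p i \<in> convex hull K" using p by blast
  have pR: "\<And>i. i \<in> {1..n} \<Longrightarrow> p i \<in> R_space d" using p' hull_subset_R_space[OF KR] by blast
  have few': "(d + 1) * card {i \<in> {1..n}. denom d q y (p i) = 0} < n"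
    if y: "y \<in> polar" and x: "x \<in> K" "denom d q y x = 0" for y x
  proof -
    let ?H = "{x \<in> R_space d. denom d q y x = 0}"
    have "support_hyperplane d K ?H"
      using y x by (intro support_hyperplane_denom_zero[OF KR]) (auto simp: polar_def)
    then have "real (card {i\<in>{1..n}. p i \<in> ?H}) < real n / real (d + 1)" using few by blast
    moreover have "{i\<in>{1..n}. p i \<in> ?H} = {i \<in> {1..n}. denom d q y (p i) = 0}"
      using pR by auto
    ultimately have "real ((d + 1) * card {i \<in> {1..n}. denom d q y (p i) = 0}) < real n"
      by (simp add: pos_less_divide_eq algebra_simps)
    then show ?thesis by (simp only: of_nat_less_iff)
  qed
  have "\<exists>y\<in>polar_interior. \<forall>y'\<in>polar_interior. objective n p y \<le> objective n p y'"
    by (rule exists_minimizer[OF cf]) (fact p' few')+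
  then obtain y where y: "y \<in> polar_interior"
    and min: "\<And>y'. y' \<in> polar_interior \<Longrightarrow> objective n p y \<le> objective n p y'"
    by blast
  let ?\<phi> = "proj_trans d q y"
  have pos: "denom d q y x \<noteq> 0" if "x \<in> convex hull K" for x
    using denom_hull_pos[OF y that] by simp
  have act: "act d ?\<phi> x = proj_map d q y x" if "x \<in> convex hull K" for x
    using that hull_subset_R_space[OF KR] by (intro act_proj_trans q_in pos) auto
  have "act d ?\<phi> ` K = proj_map d q y ` K"
    by (intro image_cong refl act hull_inc)
  moreover have "(\<Sum>i=1..n. act d ?\<phi> (p i)) = (\<Sum>i=1..n. proj_map d q y (p i))"
    by (intro sum.cong refl act p')
  ultimately have "centroid d (act d ?\<phi> ` K) = (1 / real n) *\<^sub>R (\<Sum>i=1..n. act d ?\<phi> (p i))"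
    by (simp only: centroid_at_minimizer[OF y min p' n])
  then show ?thesis
    by (intro exI[of _ ?\<phi>] conjI projective_transformation_proj_trans[OF q_in]
        admissible_proj_trans[OF KR q_in pos])
qed

section \<open>Subsets of the line\<close>

definition embed_real :: "real \<Rightarrow> point"
  where "embed_real a = (\<lambda>i. if i = 0 then a else 0)"

lemma R_space_1: "x \<in> R_space 1 \<longleftrightarrow> x = embed_real (x 0)"
  by (auto simp: R_space_iff embed_real_def fun_eq_iff)

lemma embed_real_in [simp]: "1 \<le> d \<Longrightarrow> embed_real a \<in> R_space d"
  by (simp add: R_space_iff embed_real_def)

lemma embed_real_0 [simp]: "embed_real a 0 = a"
  by (simp add: embed_real_def)

lemma embed_real_inject [simp]: "embed_real a = embed_real b \<longleftrightarrow> a = b"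
  by (metis embed_real_0)

lemma embed_real_comb: "u *\<^sub>R embed_real a + v *\<^sub>R embed_real b = embed_real (u * a + v * b)"
  by (auto simp: embed_real_def plus_fun_def scaleR_fun_def)

lemma measurable_embed_real [measurable]: "embed_real \<in> borel \<rightarrow>\<^sub>M borel"
  unfolding embed_real_def by (rule measurable_coordinatewise_then_product) measurable

lemma lborel_space_1: "lborel_space 1 = distr lborel borel embed_real"
proof -
  have one: "{..<1} = {0::nat}" by auto
  have "lborel_space 1 = distr (distr lborel (\<Pi>\<^sub>M i\<in>{0::nat}. lborel) (\<lambda>x. \<lambda>i\<in>{0}. x)) borel
      (\<lambda>x i. if i < 1 then x i else 0)"
    unfolding lborel_space_def one lborel_prod.distr_component ..
  also have "\<dots> = distr lborel borel ((\<lambda>x i. if i < 1 then x i else 0) \<circ> (\<lambda>x. \<lambda>i\<in>{0}. x))"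
    using measurable_pad[of 1] unfolding one by (intro distr_distr) (auto intro!: measurable_restrict)
  also have "(\<lambda>x i. if i < 1 then x i else 0) \<circ> (\<lambda>x. \<lambda>i\<in>{0::nat}. x) = embed_real"
    by (auto simp: embed_real_def fun_eq_iff)
  finally show ?thesis .
qed

lemma continuous_map_embed_real: "continuous_map euclideanreal (Euclidean_space 1) embed_real"
  unfolding Euclidean_space_def
  by (auto simp: continuous_map_in_subtopology continuous_map_componentwise_UNIV embed_real_def)

lemma compactin_embed_real: "compact A \<Longrightarrow> compactin (Euclidean_space 1) (embed_real ` A)"
  by (rule image_compactin[OF _ continuous_map_embed_real]) simp

lemma compact_embed_real: "compact A \<Longrightarrow> compact (embed_real ` A)"
  using compactin_embed_real by (auto simp: Euclidean_space_def compactin_subtopology euclidean_product_topology)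

lemma centroid_embed_real:
  assumes "compact A"
  shows "centroid 1 (embed_real ` A) = embed_real ((LINT a:A|lborel. a) / measure lborel A)"
proof
  fix j
  have A [measurable]: "A \<in> sets borel" "embed_real ` A \<in> sets borel"
    using assms compact_embed_real by (auto intro: borel_closed compact_imp_closed)
  have vim: "embed_real -` embed_real ` A = A" by auto
  have "measure (lborel_space 1) (embed_real ` A) = measure lborel A"
    unfolding lborel_space_1 by (subst measure_distr) (auto simp: vim)
  moreover have "(LINT x:embed_real ` A|lborel_space 1. x j) = (LINT a:A|lborel. embed_real a j)"
  proof -
    have "(LINT x|lborel_space 1. indicator (embed_real ` A) x *\<^sub>R x j) =
        (LINT a|lborel. indicator (embed_real ` A) (embed_real a) *\<^sub>R embed_real a j)"
      unfolding lborel_space_1 by (subst integral_distr) auto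
    also have "\<dots> = (LINT a|lborel. indicator A a *\<^sub>R embed_real a j)"
      by (intro Bochner_Integration.integral_cong) (auto simp: indicator_def)
    finally show ?thesis by (simp add: set_lebesgue_integral_def)
  qed
  ultimately show "centroid 1 (embed_real ` A) j = embed_real ((LINT a:A|lborel. a) / measure lborel A) j"
    by (simp add: centroid_def) (simp add: embed_real_def set_lebesgue_integral_def)
qed

lemma set_integral_id_Icc:
  assumes "u \<le> (v::real)"
  shows "set_integrable lborel {u..v} (\<lambda>a. a)" "(LINT a:{u..v}|lborel. a) = (v\<^sup>2 - u\<^sup>2) / 2"
proof -
  show "set_integrable lborel {u..v} (\<lambda>a. a)"
    by (intro borel_integrable_atLeastAtMost' continuous_intros)
  have "(LINT a:{u..v}|lborel. a) = (\<integral>x. x ^ 1 * indicator {u..v} x \<partial>lborel)"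
    by (simp add: set_lebesgue_integral_def mult.commute)
  then show "(LINT a:{u..v}|lborel. a) = (v\<^sup>2 - u\<^sup>2) / 2"
    unfolding integral_power[OF assms] by (simp add: power2_eq_square)
qed

definition three_intervals :: "real \<Rightarrow> real \<Rightarrow> real \<Rightarrow> real \<Rightarrow> real \<Rightarrow> real \<Rightarrow> real set"
  where "three_intervals u1 v1 u2 v2 u3 v3 = {u1..v1} \<union> {u2..v2} \<union> {u3..v3}"

lemma centroid_three_intervals:
  assumes "u1 \<le> v1" "v1 < u2" "u2 \<le> v2" "v2 < u3" "u3 \<le> v3"
  shows "centroid 1 (embed_real ` three_intervals u1 v1 u2 v2 u3 v3) =
    embed_real (((v1\<^sup>2 - u1\<^sup>2) + (v2\<^sup>2 - u2\<^sup>2) + (v3\<^sup>2 - u3\<^sup>2)) / 2 / ((v1 - u1) + (v2 - u2) + (v3 - u3)))"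
proof -
  let ?I = "{u1..v1}" and ?J = "{u2..v2}" and ?K = "{u3..v3}"
  have disj: "?I \<inter> ?J = {}" "(?I \<union> ?J) \<inter> ?K = {}" using assms by auto
  have int: "set_integrable lborel ?I (\<lambda>a. a)" "set_integrable lborel ?J (\<lambda>a. a)" "set_integrable lborel ?K (\<lambda>a. a)"
    using assms by (auto intro: set_integral_id_Icc)
  have "(LINT a:?I \<union> ?J \<union> ?K|lborel. a) = (v1\<^sup>2 - u1\<^sup>2) / 2 + (v2\<^sup>2 - u2\<^sup>2) / 2 + (v3\<^sup>2 - u3\<^sup>2) / 2"
    using assms disj int by (simp add: set_integral_Un set_integrable_Un set_integral_id_Icc)
  moreover have "emeasure lborel (?I \<union> ?J \<union> ?K) = ennreal ((v1 - u1) + (v2 - u2) + (v3 - u3))"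
    using assms disj by (simp add: plus_emeasure[symmetric] ennreal_plus[symmetric] del: ennreal_plus)
  then have "measure lborel (?I \<union> ?J \<union> ?K) = (v1 - u1) + (v2 - u2) + (v3 - u3)"
    using assms by (simp add: measure_def del: ennreal_plus)
  ultimately show ?thesis
    unfolding three_intervals_def
    by (subst centroid_embed_real) (auto intro!: compact_Un simp: add_divide_distrib diff_divide_distrib)
qed

lemma embed_real_hull_subset: "convex A \<Longrightarrow> convex hull (embed_real ` A) \<subseteq> embed_real ` A"
  by (rule hull_minimal) (auto simp: convex_def embed_real_comb)

lemma cusp_free_embed_real:
  assumes "\<And>a. a \<in> A \<Longrightarrow> \<exists>u v. u < v \<and> a \<in> {u..v} \<and> {u..v} \<subseteq> A"
  shows "cusp_free 1 (embed_real ` A)"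
  unfolding cusp_free_def
proof
  fix x assume "x \<in> embed_real ` A \<inter> Euclidean_space 1 frontier_of (convex hull (embed_real ` A))"
  then obtain a where a: "a \<in> A" "x = embed_real a" by blast
  obtain u v where uv: "u < v" "a \<in> {u..v}" "{u..v} \<subseteq> A" using assms[OF a(1)] by blast
  obtain b where b: "b \<in> {u..v}" "b \<noteq> a" using uv(1) by (metis atLeastAtMost_iff less_le order_refl)
  have "convex hull {embed_real a, embed_real b} \<subseteq> convex hull (embed_real ` {u..v})"
    using uv(2) b(1) by (intro hull_mono) auto
  also have "\<dots> \<subseteq> embed_real ` {u..v}" by (rule embed_real_hull_subset) (rule convex_real_interval)
  also have "\<dots> \<subseteq> embed_real ` A" using uv(3) by blast
  finally show "\<exists>C. \<not> affine_dependent C \<and> card C = 1 + 1 \<and> x \<in> C \<and> convex hull C \<subseteq> embed_real ` A"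
    using b(2) a(2) by (intro exI[of _ "{embed_real a, embed_real b}"]) auto
qed

lemma full_dimensional_embed_real:
  assumes "a \<in> A" "b \<in> A" "a \<noteq> b"
  shows "full_dimensional 1 (embed_real ` A)"
proof -
  have "x \<in> affine hull (embed_real ` A)" if "x \<in> R_space 1" for x
  proof -
    define t where "t = (x 0 - a) / (b - a)"
    have "(1 - t) * a + t * b = a + t * (b - a)" by (simp add: algebra_simps)
    also have "\<dots> = x 0" using assms(3) by (simp add: t_def)
    finally have "x = (1 - t) *\<^sub>R embed_real a + t *\<^sub>R embed_real b"
      using that by (simp add: embed_real_comb R_space_1[symmetric])
    also have "\<dots> \<in> affine hull (embed_real ` A)"
      using assms by (intro mem_affine affine_affine_hull hull_inc imageI) auto
    finally show ?thesis .
  qed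
  moreover have "affine hull (embed_real ` A) \<subseteq> R_space 1"
    by (rule hull_minimal) (auto simp: affine_def R_space_iff plus_fun_def scaleR_fun_def embed_real_def)
  ultimately show ?thesis by (auto simp: full_dimensional_def)
qed

lemma regular_embed_real:
  assumes "compact A" and A: "\<And>a. a \<in> A \<Longrightarrow> \<exists>u v. u < v \<and> a \<in> {u..v} \<and> {u..v} \<subseteq> A"
  shows "embed_real ` A = Euclidean_space 1 closure_of (Euclidean_space 1 interior_of (embed_real ` A))"
proof
  let ?E = "Euclidean_space 1"
  have "closedin ?E (embed_real ` A)"
    unfolding closedin_Euclidean_space_iff
    using compact_imp_closed[OF compact_embed_real[OF assms(1)]] embed_real_in by blast
  then show "?E closure_of (?E interior_of (embed_real ` A)) \<subseteq> embed_real ` A"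
    by (intro closure_of_minimal interior_of_subset)
  show "embed_real ` A \<subseteq> ?E closure_of (?E interior_of (embed_real ` A))"
  proof
    fix x assume "x \<in> embed_real ` A"
    then obtain a where a: "a \<in> A" "x = embed_real a" by blast
    obtain u v where uv: "u < v" "a \<in> {u..v}" "{u..v} \<subseteq> A" using A[OF a(1)] by blast
    have cont: "continuous_map ?E euclideanreal (\<lambda>x. x 0)"
      unfolding Euclidean_space_def
      by (intro continuous_map_from_subtopology continuous_map_product_projection) auto
    have "openin ?E {x \<in> R_space 1. x 0 \<in> {u<..<v}}"
      by (rule openin_continuous_map_preimage[OF cont]) auto
    moreover have "{x \<in> R_space 1. x 0 \<in> {u<..<v}} = embed_real ` {u<..<v}"
    proof (intro equalityI subsetI)
      fix x assume "x \<in> {x \<in> R_space 1. x 0 \<in> {u<..<v}}"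
      then show "x \<in> embed_real ` {u<..<v}" by (intro image_eqI[of _ _ "x 0"]) (auto simp: R_space_1[symmetric])
    qed auto
    ultimately have "openin ?E (embed_real ` {u<..<v})" by simp
    moreover have "embed_real ` {u<..<v} \<subseteq> embed_real ` A" using uv(3) by (intro image_mono) auto
    ultimately have "embed_real ` {u<..<v} \<subseteq> ?E interior_of (embed_real ` A)"
      by (intro interior_of_maximal)
    then have "?E closure_of (embed_real ` {u<..<v}) \<subseteq> ?E closure_of (?E interior_of (embed_real ` A))"
      by (rule closure_of_mono)
    moreover have "embed_real ` (euclideanreal closure_of {u<..<v}) \<subseteq> ?E closure_of (embed_real ` {u<..<v})"
      by (rule continuous_map_image_closure_subset[OF continuous_map_embed_real])
    moreover have "a \<in> euclideanreal closure_of {u<..<v}"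
      using uv(1,2) by simp
    ultimately show "x \<in> ?E closure_of (?E interior_of (embed_real ` A))" using a(2) by blast
  qed
qed

lemma support_hyperplane_embed_misses:
  assumes H: "support_hyperplane 1 (embed_real ` A) H" and ab: "a \<in> A" "b \<in> A" "a < c" "c < b"
  shows "embed_real c \<notin> H"
proof
  assume c: "embed_real c \<in> H"
  obtain f e and i :: nat where "i < 1" "f i \<noteq> (0::real)" and Hf: "H = {x \<in> R_space 1. (\<Sum>i<1. f i * x i) = e}"
    and side: "embed_real ` A \<subseteq> {x \<in> R_space 1. (\<Sum>i<1. f i * x i) \<le> e} \<or>
      embed_real ` A \<subseteq> {x \<in> R_space 1. (\<Sum>i<1. f i * x i) \<ge> e}"
    using H unfolding support_hyperplane_def by (elim conjE exE) (rule that)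
  then have f: "f 0 \<noteq> 0" by simp
  have e: "f 0 * c = e" using c Hf by simp
  from side have "f 0 * (a - c) \<le> 0 \<and> f 0 * (b - c) \<le> 0 \<or> f 0 * (a - c) \<ge> 0 \<and> f 0 * (b - c) \<ge> 0"
    using ab(1,2) by (auto simp: right_diff_distrib e image_subset_iff)
  then show False using f ab(3,4) by (auto simp: mult_le_0_iff zero_le_mult_iff)
qed

section \<open>Two inequivalent solutions\<close>

lemma projective_transformation_id: "projective_transformation d id"
  unfolding projective_transformation_def by (intro exI[of _ id]) (auto simp: linear_id)

lemma act_id: "x \<in> R_space d \<Longrightarrow> act d id x = x"
  by (rule act_eqI) auto

lemma chart_in_RP: "x \<in> R_space d \<Longrightarrow> chart x \<in> RP d"
  unfolding RP_def chart_def
  by (auto simp: R_space_iff fun_eq_iff zero_fun_def split: nat.split intro!: exI[of _ "case_nat 1 x"])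

text \<open>
  It sends the point \<open>x\<close> of the affine chart to infinity.
\<close>

lemma proj_trans_not_affine:
  assumes x: "x \<in> R_space d" "denom d q y x = 0"
  shows "\<not> affine_transformation d (proj_trans d q y \<circ> inv_into (RP d) id)"
proof
  assume "affine_transformation d (proj_trans d q y \<circ> inv_into (RP d) id)"
  then obtain z where "(proj_trans d q y \<circ> inv_into (RP d) id) (chart x) = chart z"
    unfolding affine_transformation_def using x(1) by blast
  moreover have "inv_into (RP d) id (chart x) = chart x"
    using inv_into_f_f[of id "RP d" "chart x"] chart_in_RP[OF x(1)] by simp
  ultimately have "proj_lin d q y ` chart x = chart z" by (simp add: proj_trans_def)
  moreover have "case_nat 1 z \<in> chart z" unfolding chart_def by (rule span_base) simp
  ultimately obtain k where "case_nat 1 z = proj_lin d q y (k *\<^sub>R case_nat 1 x)"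
    by (auto simp: chart_eq)
  then have "case_nat 1 z = k *\<^sub>R case_nat (denom d q y x) (\<lambda>i. x i - q i)"
    by (simp add: linear_scale[OF linear_proj_lin] proj_lin_chart)
  then have "(case_nat 1 z :: point) 0 = (k *\<^sub>R case_nat (denom d q y x) (\<lambda>i. x i - q i)) 0" by simp
  then show False using x(2) by (simp add: scaleR_fun_def)
qed

text \<open>
  The set is \<open>[-6, -5] \<union> [-3, 3] \<union> [5, 6]\<close> with the two points \<open>\<plusminus>s\<close>. The identity is a solution by
  symmetry. The second solution is \<open>a \<mapsto> 15 a / (15 - a)\<close>: it maps the set to
  \<open>[-30/7, -15/4] \<union> [-5/2, 15/4] \<union> [15/2, 10]\<close>, whose centroid is \<open>285/112\<close>, and the mean of the images
  of the two points is \<open>15 s\<^sup>2 / (225 - s\<^sup>2)\<close>. Equating the two gives \<open>s\<^sup>2 = 4275/131 < 36\<close>.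
\<close>

lemma projective_centering_not_unique:
  "\<exists>(d::nat) (K::point set) (n::nat) (p::nat \<Rightarrow> point).
    1 \<le> d \<and> compactin (Euclidean_space d) K \<and> full_dimensional d K \<and> cusp_free d K \<and>
    K = Euclidean_space d closure_of (Euclidean_space d interior_of K) \<and>
    (\<forall>i\<in>{1..n}. p i \<in> convex hull K) \<and>
    (\<forall>H. support_hyperplane d K H \<longrightarrow>
      real (card {i\<in>{1..n}. p i \<in> H}) < real n / real (d + 1)) \<and>
    (\<exists>\<phi> \<psi>. projective_transformation d \<phi> \<and> admissible d \<phi> K \<and>
      projective_transformation d \<psi> \<and> admissible d \<psi> K \<and>
      centroid d (act d \<phi> ` K) = (1 / real n) *\<^sub>R (\<Sum>i=1..n. act d \<phi> (p i)) \<and>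
      centroid d (act d \<psi> ` K) = (1 / real n) *\<^sub>R (\<Sum>i=1..n. act d \<psi> (p i)) \<and>
      \<not> affine_transformation d (\<phi> \<circ> inv_into (RP d) \<psi>))"
proof -
  note One_nat_def [simp del]
  define A where "A = three_intervals (-6) (-5) (-3) 3 5 6"
  define K where "K = embed_real ` A"
  define s where "s = sqrt (4275 / 131)"
  have s2: "s\<^sup>2 = 4275 / 131" by (simp add: s_def)
  have "0 < s" by (simp add: s_def)
  moreover have "s\<^sup>2 < 6\<^sup>2" by (simp add: s2)
  then have "s < 6" by (rule power2_less_imp_less) simp
  ultimately have s: "-6 < s" "s < 6" "-6 < -s" "-s < 6" by auto
  define p where "p i = embed_real (if i = 1 then s else - s)" for i :: nat
  have sum_p: "(\<Sum>i=1..2. f (p i)) = f (embed_real s) + f (embed_real (- s))" for f :: "point \<Rightarrow> point"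
    by (simp add: p_def numeral_2_eq_2)
  define y where "y = embed_real (1 / 15)"
  define \<phi> where "\<phi> = proj_trans 1 (\<lambda>_. 0) y"
  have zero_in: "(\<lambda>_. 0) \<in> R_space 1" by (simp add: R_space_iff)
  have A: "\<exists>u v. u < v \<and> a \<in> {u..v} \<and> {u..v} \<subseteq> A" if "a \<in> A" for a
  proof -
    from that consider "a \<in> {-6..-5}" | "a \<in> {-3..3}" | "a \<in> {5..6}"
      by (auto simp: A_def three_intervals_def)
    then show ?thesis
    proof cases
      case 1
      then show ?thesis by (intro exI[of _ "-6"] exI[of _ "-5"]) (auto simp: A_def three_intervals_def)
    next
      case 2
      then show ?thesis by (intro exI[of _ "-3"] exI[of _ "3"]) (auto simp: A_def three_intervals_def)
    next
      case 3
      then show ?thesis by (intro exI[of _ "5"] exI[of _ "6"]) (auto simp: A_def three_intervals_def)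
    qed
  qed
  have compA: "compact A" by (auto simp: A_def three_intervals_def intro!: compact_Un)
  have mem: "-6 \<in> A" "6 \<in> A" by (auto simp: A_def three_intervals_def)
  have KR: "K \<subseteq> R_space 1" by (auto simp: K_def)
  have hullK: "convex hull K \<subseteq> embed_real ` {-6..6}"
  proof -
    have "convex hull K \<subseteq> convex hull (embed_real ` {-6..6})"
      unfolding K_def by (intro hull_mono image_mono) (auto simp: A_def three_intervals_def)
    also have "\<dots> \<subseteq> embed_real ` {-6..6}" by (rule embed_real_hull_subset) (rule convex_real_interval)
    finally show ?thesis .
  qed
  have in_hull: "embed_real c \<in> convex hull K" if "-6 < c" "c < 6" for c
  proof -
    have "((6 - c) / 12) *\<^sub>R embed_real (-6) + ((6 + c) / 12) *\<^sub>R embed_real 6 \<in> convex hull K"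
      using that mem unfolding K_def
      by (intro convexD[OF convex_convex_hull] hull_inc imageI) (auto simp: field_simps)
    also have "((6 - c) / 12) *\<^sub>R embed_real (-6) + ((6 + c) / 12) *\<^sub>R embed_real 6 = embed_real c"
      by (simp add: embed_real_comb field_simps)
    finally show ?thesis .
  qed
  have p_hull: "\<forall>i\<in>{1..2}. p i \<in> convex hull K"
    using in_hull s by (simp add: p_def)
  have few: "\<forall>H. support_hyperplane 1 K H \<longrightarrow> real (card {i\<in>{1..2}. p i \<in> H}) < real 2 / real (1 + 1)"
  proof (intro allI impI)
    fix H assume "support_hyperplane 1 K H"
    then have "p i \<notin> H" for i
      unfolding p_def K_def using s mem by (intro support_hyperplane_embed_misses[where a = "-6" and b = 6]) auto
    then show "real (card {i\<in>{1..2}. p i \<in> H}) < real 2 / real (1 + 1)" by simp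
  qed
  have den: "denom 1 (\<lambda>_. 0) y (embed_real a) = 1 - a / 15" for a
    by (simp add: denom_def y_def)
  have den_pos: "denom 1 (\<lambda>_. 0) y x \<noteq> 0" if x: "x \<in> convex hull K" for x
  proof -
    obtain a where "x = embed_real a" "a \<in> {-6..6}" using x hullK by blast
    then show ?thesis using den[of a] by auto
  qed
  have act_\<phi>: "act 1 \<phi> (embed_real a) = embed_real (15 * a / (15 - a))" if "a < 15" for a
  proof -
    have "act 1 \<phi> (embed_real a) = proj_map 1 (\<lambda>_. 0) y (embed_real a)"
      unfolding \<phi>_def using that by (intro act_proj_trans zero_in) (auto simp: den)
    also have "\<dots> = embed_real (15 * a / (15 - a))"
      using that unfolding proj_map_def den by (auto simp: embed_real_def fun_eq_iff field_simps)
    finally show ?thesis .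
  qed
  have img: "(\<lambda>a. 15 * a / (15 - a)) ` {u..v} = {15 * u / (15 - u)..15 * v / (15 - v)}"
    if uv: "-15 < u" "u \<le> v" "v < 15" for u v :: real
  proof (intro equalityI subsetI)
    fix z assume "z \<in> (\<lambda>a. 15 * a / (15 - a)) ` {u..v}"
    moreover have "15 * a / (15 - a) \<le> 15 * b / (15 - b)" if "a \<le> b" "b < 15" for a b :: real
      using that by (simp add: pos_divide_le_eq pos_le_divide_eq algebra_simps)
    ultimately show "z \<in> {15 * u / (15 - u)..15 * v / (15 - v)}"
      using uv by auto
  next
    fix z assume z: "z \<in> {15 * u / (15 - u)..15 * v / (15 - v)}"
    then have z': "15 * u \<le> z * (15 - u)" "z * (15 - v) \<le> 15 * v"
      using uv by (simp_all add: pos_divide_le_eq pos_le_divide_eq)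
    have "15 * u / (15 - u) > - 15" using uv by (simp add: pos_less_divide_eq)
    then have z15: "15 + z > 0" using z by auto
    have "z = 15 * (15 * z / (15 + z)) / (15 - 15 * z / (15 + z))"
      using z15 by (simp add: divide_simps)
    moreover have "15 * z / (15 + z) \<in> {u..v}"
      using z' z15 by (simp add: pos_le_divide_eq pos_divide_le_eq algebra_simps)
    ultimately show "z \<in> (\<lambda>a. 15 * a / (15 - a)) ` {u..v}" by (rule image_eqI)
  qed
  have "act 1 \<phi> ` K = embed_real ` (\<lambda>a. 15 * a / (15 - a)) ` A"
    unfolding K_def image_image
    by (intro image_cong refl act_\<phi>) (auto simp: A_def three_intervals_def)
  also have "(\<lambda>a. 15 * a / (15 - a)) ` A = three_intervals (-30/7) (-15/4) (-5/2) (15/4) (15/2) 10"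
    unfolding A_def three_intervals_def image_Un by (simp add: img)
  finally have act_K: "act 1 \<phi> ` K = embed_real ` three_intervals (-30/7) (-15/4) (-5/2) (15/4) (15/2) 10" .
  have "centroid 1 (act 1 \<phi> ` K) = embed_real (285 / 112)"
    unfolding act_K by (subst centroid_three_intervals) (simp_all add: power2_eq_square)
  moreover have "(1 / real 2) *\<^sub>R (\<Sum>i=1..2. act 1 \<phi> (p i)) = embed_real (285 / 112)"
  proof -
    have "(1 / real 2) *\<^sub>R (\<Sum>i=1..2. act 1 \<phi> (p i)) =
        (1 / 2) *\<^sub>R embed_real (15 * s / (15 - s)) + (1 / 2) *\<^sub>R embed_real (15 * (- s) / (15 - (- s)))"
      unfolding sum_p using s by (simp add: act_\<phi> scaleR_add_right)
    also have "\<dots> = embed_real ((15 * s / (15 - s) + 15 * (- s) / (15 - (- s))) / 2)"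
    proof -
      have "1 / 2 * a + 1 / 2 * b = (a + b) / 2" for a b :: real by simp
      then show ?thesis by (simp only: embed_real_comb)
    qed
    also have "(15 * s / (15 - s) + 15 * (- s) / (15 - (- s))) / 2 = 15 * s\<^sup>2 / (225 - s\<^sup>2)"
    proof -
      have "15 - s \<noteq> 0" "15 + s \<noteq> 0" using s by auto
      moreover have "225 - s\<^sup>2 = (15 - s) * (15 + s)" by (simp add: power2_eq_square algebra_simps)
      ultimately show ?thesis by (simp add: divide_simps) (simp add: power2_eq_square algebra_simps)
    qed
    also have "\<dots> = 285 / 112" unfolding s2 by simp
    finally show ?thesis .
  qed
  ultimately have cen_\<phi>: "centroid 1 (act 1 \<phi> ` K) = (1 / real 2) *\<^sub>R (\<Sum>i=1..2. act 1 \<phi> (p i))" by simp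
  have "act 1 id ` K = K" using KR by (auto simp: act_id image_iff subset_iff)
  moreover have "centroid 1 K = embed_real 0"
    unfolding K_def A_def by (subst centroid_three_intervals) simp_all
  moreover have "(1 / real 2) *\<^sub>R (\<Sum>i=1..2. act 1 id (p i)) = embed_real 0"
    unfolding sum_p using embed_real_comb[of "1 / 2" s "1 / 2" "- s"]
    by (simp add: act_id scaleR_add_right)
  ultimately have cen_id: "centroid 1 (act 1 id ` K) = (1 / real 2) *\<^sub>R (\<Sum>i=1..2. act 1 id (p i))" by simp
  have adm_id: "admissible 1 id K"
    unfolding admissible_def using hull_subset_R_space[OF KR] by auto
  have not_affine: "\<not> affine_transformation 1 (\<phi> \<circ> inv_into (RP 1) id)"
    unfolding \<phi>_def by (rule proj_trans_not_affine[where x = "embed_real 15"]) (simp_all add: den)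
  show ?thesis
  proof (rule exI[of _ 1], rule exI[of _ K], rule exI[of _ 2], rule exI[of _ p], intro conjI)
    show "compactin (Euclidean_space 1) K" unfolding K_def by (rule compactin_embed_real[OF compA])
    show "full_dimensional 1 K" unfolding K_def by (rule full_dimensional_embed_real[OF mem]) simp
    show "cusp_free 1 K" unfolding K_def by (rule cusp_free_embed_real[OF A])
    show "K = Euclidean_space 1 closure_of (Euclidean_space 1 interior_of K)"
      unfolding K_def by (rule regular_embed_real[OF compA A])
    have \<phi>: "projective_transformation 1 \<phi>" "admissible 1 \<phi> K"
      unfolding \<phi>_def
      by (rule projective_transformation_proj_trans[OF zero_in], rule admissible_proj_trans[OF KR zero_in den_pos])
    show "\<exists>\<phi> \<psi>. projective_transformation 1 \<phi> \<and> admissible 1 \<phi> K \<and>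
      projective_transformation 1 \<psi> \<and> admissible 1 \<psi> K \<and>
      centroid 1 (act 1 \<phi> ` K) = (1 / real 2) *\<^sub>R (\<Sum>i=1..2. act 1 \<phi> (p i)) \<and>
      centroid 1 (act 1 \<psi> ` K) = (1 / real 2) *\<^sub>R (\<Sum>i=1..2. act 1 \<psi> (p i)) \<and>
      \<not> affine_transformation 1 (\<phi> \<circ> inv_into (RP 1) \<psi>)"
      by (rule exI[of _ \<phi>], rule exI[of _ id], intro conjI)
        (fact \<phi> projective_transformation_id adm_id cen_\<phi> cen_id not_affine)+
  qed (fact p_hull few | simp)+
qed

theorem theorem4:
  shows "(\<forall>(d::nat) (K::(nat \<Rightarrow> real) set) (n::nat) (p::nat \<Rightarrow> nat \<Rightarrow> real).
        1 \<le> d \<and> compactin (Euclidean_space d) K \<and> full_dimensional d K \<and> cusp_free d K \<and>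
        K = Euclidean_space d closure_of (Euclidean_space d interior_of K) \<and>
        (\<forall>i\<in>{1..n}. p i \<in> convex hull K) \<and>
        (\<forall>H. support_hyperplane d K H \<longrightarrow>
          real (card {i\<in>{1..n}. p i \<in> H}) < real n / real (d + 1)) \<longrightarrow>
        (\<exists>\<phi>. projective_transformation d \<phi> \<and> admissible d \<phi> K \<and>
          centroid d (act d \<phi> ` K) = (1 / real n) *\<^sub>R (\<Sum>i=1..n. act d \<phi> (p i))))
    \<and> (\<exists>(d::nat) (K::(nat \<Rightarrow> real) set) (n::nat) (p::nat \<Rightarrow> nat \<Rightarrow> real).
        1 \<le> d \<and> compactin (Euclidean_space d) K \<and> full_dimensional d K \<and> cusp_free d K \<and>
        K = Euclidean_space d closure_of (Euclidean_space d interior_of K) \<and>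
        (\<forall>i\<in>{1..n}. p i \<in> convex hull K) \<and>
        (\<forall>H. support_hyperplane d K H \<longrightarrow>
          real (card {i\<in>{1..n}. p i \<in> H}) < real n / real (d + 1)) \<and>
        (\<exists>\<phi> \<psi>. projective_transformation d \<phi> \<and> admissible d \<phi> K \<and>
          projective_transformation d \<psi> \<and> admissible d \<psi> K \<and>
          centroid d (act d \<phi> ` K) = (1 / real n) *\<^sub>R (\<Sum>i=1..n. act d \<phi> (p i)) \<and>
          centroid d (act d \<psi> ` K) = (1 / real n) *\<^sub>R (\<Sum>i=1..n. act d \<psi> (p i)) \<and>
          \<not> affine_transformation d (\<phi> \<circ> inv_into (RP d) \<psi>)))"
  by (intro conjI allI impI projective_centering_not_unique)
    (elim conjE, rule exists_projective_centering)

end
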